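(* Let $E_{ij}$, $1\le i,j\le n$, be the standard basis of the Lie algebra $\mathfrak{gl}_n$ over $\mathbb C$ (matrix units), with $[E_{ij},E_{kl}]=\delta_{jk}E_{il}-\delta_{il}E_{kj}$. Let $\det(E)\in S(\mathfrak{gl}_n)=\mathbb C[E_{ij}]$ be the ordinary determinant of the matrix $E=(E_{ij})$ with entries regarded as commuting generators of the symmetric algebra $S(\mathfrak{gl}_n)$. Then $$\mathrm{Duflo}(\det(E))={\det}^{\mathrm{col}}\Big(E+\mathrm{diag}(n-1,n-2,\dots,1,0)-\tfrac{n-1}{2}\,\mathrm{Id}\Big)\in U(\mathfrak{gl}_n),$$ where on the right-hand side $E$ is the matrix whose entries are the generators $E_{ij}$ of the universal enveloping algebra $U(\mathfrak{gl}_n)$.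
   Context: For a finite-dimensional Lie algebra $\mathfrak g$ over a field of characteristic zero, the Duflo map $\mathrm{Duflo}:S(\mathfrak g)\to U(\mathfrak g)$ is the composition $\mathrm{Sym}\circ J^{1/2}(\partial)$, where $\mathrm{Sym}:S(\mathfrak g)\to U(\mathfrak g)$ is the Poincaré–Birkhoff–Witt symmetrization map and $J^{1/2}(\partial)$ is the infinite-order constant-coefficient differential operator on $S(\mathfrak g)=\mathrm{Pol}(\mathfrak g^* )$ associated with the formal power series $J^{1/2}(x)=\det\left(\frac{\sinh(\mathrm{ad}_x/2)}{\mathrm{ad}_x/2}\right)^{1/2}$ on $\mathfrak g$ (for $\mathfrak{gl}_n$, which is unimodular, this agrees with $\det\left(\frac{1-e^{-\mathrm{ad}_x}}{\mathrm{ad}_x}\right)^{1/2}$). Its restriction to invariants is an isomorphism of commutative algebras $S(\mathfrak g)^{\mathfrak g}\to U(\mathfrak g)^{\mathfrak g}=Z(U(\mathfrak g))$. The column-determinant of an $N\times N$ matrix $M$ over a not necessarily commutative ring is ${\det}^{\mathrm{col}}M=\sum_{\sigma\in S_N}\mathrm{sgn}(\sigma)\,M_{\sigma(1)1}M_{\sigma(2)2}\cdots M_{\sigma(N)N}$ (factors ordered by column). *)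

theory Defs
  imports "HOL-Analysis.Analysis" "HOL-Library.Poly_Mapping"
    "HOL-Computational_Algebra.Formal_Power_Series"
begin

no_notation vec_nth (infixl "$" 90)
unbundle fps_syntax
notation vec_nth (infixl "$h" 90)

section \<open>Finite-dimensional complex Lie algebras with a distinguished basis\<close>

text \<open>
  A type of this class indexes a basis \<open>e\<^sub>a\<close> of a finite-dimensional complex Lie algebra,
  presented by its structure constants: \<open>[e\<^sub>a, e\<^sub>b] = (\<Sum>c. lie_sc a b c \<cdot> e\<^sub>c)\<close>.
\<close>

class lie_basis = finite +
  fixes lie_sc :: "'a \<Rightarrow> 'a \<Rightarrow> 'a \<Rightarrow> complex"
  assumes lie_sc_antisym: "lie_sc a b c = - lie_sc b a c"
    and lie_sc_jacobi:
      "(\<Sum>d\<in>UNIV. lie_sc a b d * lie_sc d c e + lie_sc b c d * lie_sc d a e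
          + lie_sc c a d * lie_sc d b e) = 0"

section \<open>The symmetric algebra\<close>

text \<open>
  \<open>S(\<gg>) = \<complex>[e\<^sub>a]\<close>, with monomials represented by exponent vectors. The same type also
  serves for \<open>Pol(\<gg>)\<close>, with one variable for each coordinate \<open>t\<^sub>a\<close> on \<open>\<gg>\<close>, where
  \<open>x = (\<Sum>a. t\<^sub>a(x) \<cdot> e\<^sub>a)\<close>.
\<close>

type_synonym 'b mpoly = "('b \<Rightarrow>\<^sub>0 nat) \<Rightarrow>\<^sub>0 complex"

definition mconst :: "complex \<Rightarrow> 'b mpoly" where
  "mconst c = Poly_Mapping.single 0 c"

definition mvar :: "'b \<Rightarrow> 'b mpoly" where
  "mvar a = Poly_Mapping.single (Poly_Mapping.single a 1) 1"

section \<open>The universal enveloping algebra\<close>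

text \<open>The free monoid, so that \<open>'b word \<Rightarrow>\<^sub>0 complex\<close> is the free associative algebra.\<close>

datatype 'a word = Word (letters: "'a list")

instantiation word :: (type) monoid_add
begin

definition zero_word :: "'a word" where
  "0 = Word []"

definition plus_word :: "'a word \<Rightarrow> 'a word \<Rightarrow> 'a word" where
  "u + v = Word (letters u @ letters v)"

instance
  by standard (simp_all add: zero_word_def plus_word_def)

end

type_synonym 'b free_alg = "'b word \<Rightarrow>\<^sub>0 complex"

definition fconst :: "complex \<Rightarrow> 'b free_alg" where
  "fconst c = Poly_Mapping.single 0 c"

definition fvar :: "'b \<Rightarrow> 'b free_alg" where
  "fvar a = Poly_Mapping.single (Word [a]) 1"

definition lie_relator :: "'b::lie_basis \<Rightarrow> 'b \<Rightarrow> 'b free_alg" where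
  "lie_relator a b =
     fvar a * fvar b - fvar b * fvar a - (\<Sum>c\<in>UNIV. fconst (lie_sc a b c) * fvar c)"

inductive_set lie_ideal :: "'b::lie_basis free_alg set" where
  lie_ideal_zero: "0 \<in> lie_ideal"
| lie_ideal_relator: "p * lie_relator a b * q \<in> lie_ideal"
| lie_ideal_add: "p \<in> lie_ideal \<Longrightarrow> q \<in> lie_ideal \<Longrightarrow> p + q \<in> lie_ideal"

lemma lie_ideal_mult:
  assumes "p \<in> lie_ideal"
  shows "r * p * s \<in> lie_ideal"
  using assms
proof induction
  case (lie_ideal_relator p a b q)
  have "r * (p * lie_relator a b * q) * s = (r * p) * lie_relator a b * (q * s)"
    by (simp add: mult.assoc)
  then show ?case
    using lie_ideal.lie_ideal_relator[of "r * p" a b "q * s"] by simp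
qed (simp_all add: distrib_left distrib_right lie_ideal.intros)

lemma lie_ideal_mult_left: "p \<in> lie_ideal \<Longrightarrow> r * p \<in> lie_ideal"
  using lie_ideal_mult[of p r 1] by simp

lemma lie_ideal_mult_right: "p \<in> lie_ideal \<Longrightarrow> p * s \<in> lie_ideal"
  using lie_ideal_mult[of p 1 s] by simp

lemma lie_ideal_uminus: "p \<in> lie_ideal \<Longrightarrow> - p \<in> lie_ideal"
  using lie_ideal_mult_left[of p "- 1"] by simp

lemma lookup_times_empty_word:
  fixes p q :: "'a free_alg"
  shows "Poly_Mapping.lookup (p * q) 0 = Poly_Mapping.lookup p 0 * Poly_Mapping.lookup q 0"
proof -
  have split: "0 = u + v \<longleftrightarrow> u = 0 \<and> v = 0" for u v :: "'a word"
    by (cases u; cases v) (auto simp: zero_word_def plus_word_def)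
  have "Poly_Mapping.lookup (p * q) 0 =
      Sum_any (\<lambda>u. Poly_Mapping.lookup p u * Sum_any (\<lambda>v. Poly_Mapping.lookup q v when 0 = u + v))"
    by (simp add: lookup_mult)
  also have "\<dots> = Sum_any (\<lambda>u. (Poly_Mapping.lookup p u * Poly_Mapping.lookup q 0) when u = 0)"
    by (intro arg_cong[where f = Sum_any] ext) (auto simp: split when_def)
  finally show ?thesis
    by simp
qed

lemma lie_ideal_augmentation: "p \<in> lie_ideal \<Longrightarrow> Poly_Mapping.lookup p 0 = 0"
proof (induction rule: lie_ideal.induct)
  case (lie_ideal_relator p a b q)
  have "Poly_Mapping.lookup (fvar c) 0 = 0" for c :: 'a
    by (simp add: fvar_def lookup_single zero_word_def when_def)
  then show ?case
    by (simp add: lookup_times_empty_word lie_relator_def lookup_minus lookup_sum)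
qed (simp_all add: lookup_add)

definition lie_cong :: "'b::lie_basis free_alg \<Rightarrow> 'b free_alg \<Rightarrow> bool" where
  "lie_cong p q \<longleftrightarrow> p - q \<in> lie_ideal"

lemma equivp_lie_cong: "equivp lie_cong"
proof (rule equivpI)
  show "reflp lie_cong"
    by (simp add: reflp_def lie_cong_def lie_ideal_zero)
  show "symp lie_cong"
    unfolding symp_def lie_cong_def using lie_ideal_uminus by fastforce
  show "transp lie_cong"
    unfolding transp_def lie_cong_def
    using lie_ideal_add by fastforce
qed

quotient_type (overloaded) 'b uea = "'b::lie_basis free_alg" / lie_cong
  by (rule equivp_lie_cong)

instantiation uea :: (lie_basis) ring_1
begin

lift_definition zero_uea :: "'a uea" is 0 .

lift_definition one_uea :: "'a uea" is 1 .

lift_definition plus_uea :: "'a uea \<Rightarrow> 'a uea \<Rightarrow> 'a uea" is plus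
proof -
  fix p p' q q' :: "'a free_alg"
  assume "lie_cong p p'" and "lie_cong q q'"
  then have "(p - p') + (q - q') \<in> lie_ideal"
    unfolding lie_cong_def by (rule lie_ideal_add)
  then show "lie_cong (p + q) (p' + q')"
    unfolding lie_cong_def by (simp add: algebra_simps)
qed

lift_definition uminus_uea :: "'a uea \<Rightarrow> 'a uea" is uminus
  unfolding lie_cong_def by (drule lie_ideal_uminus) simp

lift_definition minus_uea :: "'a uea \<Rightarrow> 'a uea \<Rightarrow> 'a uea" is minus
proof -
  fix p p' q q' :: "'a free_alg"
  assume "lie_cong p p'" and "lie_cong q q'"
  then have "(p - p') + - (q - q') \<in> lie_ideal"
    unfolding lie_cong_def by (intro lie_ideal_add lie_ideal_uminus)
  then show "lie_cong (p - q) (p' - q')"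
    unfolding lie_cong_def by (simp add: algebra_simps)
qed

lift_definition times_uea :: "'a uea \<Rightarrow> 'a uea \<Rightarrow> 'a uea" is times
proof -
  fix p p' q q' :: "'a free_alg"
  assume "lie_cong p p'" and "lie_cong q q'"
  then have "(p - p') * q + p' * (q - q') \<in> lie_ideal"
    unfolding lie_cong_def
    by (intro lie_ideal_add lie_ideal_mult_left lie_ideal_mult_right)
  then show "lie_cong (p * q) (p' * q')"
    unfolding lie_cong_def by (simp add: algebra_simps)
qed

instance
proof
  show "(0 :: 'a uea) \<noteq> 1"
  proof transfer
    show "\<not> lie_cong (0 :: 'a free_alg) 1"
      using lie_ideal_augmentation[of "0 - 1 :: 'a free_alg"]
      by (auto simp: lie_cong_def lookup_one)
  qed
qed (transfer, simp add: algebra_simps equivp_reflp[OF equivp_lie_cong])+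

end

lift_definition uconst :: "complex \<Rightarrow> 'b::lie_basis uea" is fconst .

lift_definition uvar :: "'b::lie_basis \<Rightarrow> 'b uea" is fvar .

lemma uvar_commutator:
  "uvar a * uvar b - uvar b * uvar a = (\<Sum>c\<in>UNIV. uconst (lie_sc a b c) * uvar c)"
proof -
  have sum: "abs_uea (sum f A) = (\<Sum>c\<in>A. abs_uea (f c))"
    for f :: "'a \<Rightarrow> 'a free_alg" and A
    by (induction A rule: infinite_finite_induct)
      (simp_all add: zero_uea.abs_eq flip: plus_uea.abs_eq)
  have "abs_uea (fvar a * fvar b - fvar b * fvar a) =
      abs_uea (\<Sum>c\<in>UNIV. fconst (lie_sc a b c) * fvar c)"
    using lie_ideal_relator[of 1 a b 1]
    by (simp add: uea.abs_eq_iff lie_cong_def lie_relator_def)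
  then show ?thesis
    by (simp add: sum uvar_def uconst_def times_uea.abs_eq minus_uea.abs_eq)
qed

section \<open>Symmetrization\<close>

definition sym_product :: "'b::lie_basis list \<Rightarrow> 'b uea" where
  "sym_product xs = uconst (1 / fact (length xs)) *
     (\<Sum>\<sigma> | \<sigma> permutes {..<length xs}.
        prod_list (map (\<lambda>i. uvar (xs ! \<sigma> i)) [0..<length xs]))"

text \<open>
  The factors of a monomial are listed in an arbitrary order; \<open>Sym_monomial\<close> below
  shows that the order is immaterial.
\<close>

definition monomial_factors :: "('b::finite \<Rightarrow>\<^sub>0 nat) \<Rightarrow> 'b list" where
  "monomial_factors m = (SOME xs. \<forall>a. count_list xs a = Poly_Mapping.lookup m a)"

definition Sym :: "'b::lie_basis mpoly \<Rightarrow> 'b uea" where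
  "Sym p = (\<Sum>m\<in>Poly_Mapping.keys p. uconst (Poly_Mapping.lookup p m) * sym_product (monomial_factors m))"

lemma sym_product_mset_cong:
  assumes "mset xs = mset ys"
  shows "sym_product xs = sym_product ys"
proof -
  have len: "length xs = length ys"
    using assms by (rule mset_eq_length)
  obtain \<pi> where \<pi>: "\<pi> permutes {..<length ys}" and xs: "permute_list \<pi> ys = xs"
    using assms by (rule mset_eq_permutation)
  define F where
    "F \<sigma> = prod_list (map (\<lambda>i. uvar (ys ! \<sigma> i)) [0..<length ys])" for \<sigma>
  have "prod_list (map (\<lambda>i. uvar (xs ! \<sigma> i)) [0..<length xs]) = F (\<pi> \<circ> \<sigma>)"
    if \<sigma>: "\<sigma> permutes {..<length ys}" for \<sigma>
  proof -
    have "xs ! \<sigma> i = ys ! (\<pi> \<circ> \<sigma>) i" if "i < length ys" for i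
    proof -
      have "\<sigma> i < length ys"
        using permutes_in_image[OF \<sigma>, of i] that by simp
      then show ?thesis
        using \<pi> xs permute_list_nth by fastforce
    qed
    then show ?thesis
      unfolding F_def len by (intro arg_cong[where f = prod_list] map_cong) auto
  qed
  then have "(\<Sum>\<sigma> | \<sigma> permutes {..<length xs}.
        prod_list (map (\<lambda>i. uvar (xs ! \<sigma> i)) [0..<length xs]))
      = (\<Sum>\<sigma> | \<sigma> permutes {..<length ys}. F (\<pi> \<circ> \<sigma>))"
    by (simp add: len)
  also have "\<dots> = (\<Sum>\<sigma> | \<sigma> permutes {..<length ys}. F \<sigma>)"
    using setum_permutations_compose_left[OF \<pi>, of F] by (rule sym)
  finally show ?thesis
    by (simp add: sym_product_def F_def len)
qed

lemma prod_list_mvar: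
  "prod_list (map mvar xs) = Poly_Mapping.single (\<Sum>a\<leftarrow>xs. Poly_Mapping.single a 1) 1"
  by (induction xs) (simp_all add: mvar_def mult_single)

lemma Sym_monomial: "Sym (prod_list (map mvar xs)) = sym_product xs"
proof -
  define m :: "'a \<Rightarrow>\<^sub>0 nat" where "m = (\<Sum>a\<leftarrow>xs. Poly_Mapping.single a 1)"
  have m: "Poly_Mapping.lookup m a = count_list xs a" for a
    unfolding m_def
    by (induction xs) (auto simp: lookup_add lookup_single when_def)
  have "\<forall>a. count_list (monomial_factors m) a = Poly_Mapping.lookup m a"
    unfolding monomial_factors_def by (rule someI[of _ xs]) (simp add: m)
  then have "mset (monomial_factors m) = mset xs"
    by (intro multiset_eqI) (simp add: m count_mset)
  then have "sym_product (monomial_factors m) = sym_product xs"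
    by (rule sym_product_mset_cong)
  moreover have "uconst 1 = (1 :: 'a uea)"
    by transfer (simp add: fconst_def equivp_reflp[OF equivp_lie_cong])
  ultimately show ?thesis
    using prod_list_mvar[of xs, folded m_def] by (simp add: Sym_def)
qed

section \<open>The Duflo map\<close>

text \<open>The matrix of \<open>ad\<^sub>x\<close> in the basis \<open>e\<^sub>a\<close>, with entries the linear forms in the coordinates of \<open>x\<close>.\<close>

definition ad_matrix :: "'b::lie_basis mpoly ^ 'b::lie_basis ^ 'b::lie_basis" where
  "ad_matrix = (\<chi> c b. \<Sum>a\<in>UNIV. mconst (lie_sc a b c) * mvar a)"

text \<open>\<open>sinh(z/2) / (z/2) = (exp(z/2) - exp(-z/2)) / z\<close>\<close>

definition sinhc_half :: "complex fps" where
  "sinhc_half = (fps_exp (1/2) - fps_exp (- 1/2)) / fps_X"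

text \<open>
  A formal power series on \<open>\<gg>\<close> is encoded as an element of \<open>Pol(\<gg>)[[s]]\<close> whose coefficient of
  \<open>s\<^sup>k\<close> is its homogeneous component of degree \<open>k\<close>; that is, \<open>F(x)\<close> is encoded as \<open>F(s x)\<close>.
\<close>

definition duflo_J :: "'b::lie_basis itself \<Rightarrow> 'b mpoly fps" where
  "duflo_J _ = det ((\<chi> i j. Abs_fps (\<lambda>k.
     mconst (sinhc_half $ k) * ((((**) ad_matrix) ^^ k) (mat 1)) $h i $h j)) :: 'b mpoly fps ^ 'b::lie_basis ^ 'b::lie_basis)"

definition duflo_J_sqrt :: "'b::lie_basis itself \<Rightarrow> 'b mpoly fps" where
  "duflo_J_sqrt T = (THE F. F $ 0 = 1 \<and> F ^ 2 = duflo_J T)"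

text \<open>
  The constant-coefficient operator \<open>q(\<partial>)\<close>, in which the coordinate \<open>t\<^sub>a\<close> acts as
  \<open>\<partial>/\<partial>e\<^sub>a\<close>. Here \<open>fact i * (j choose i) = j (j - 1) \<dots> (j - i + 1)\<close>, so the summand vanishes
  unless \<open>\<alpha> \<le> m\<close> pointwise, in which case \<open>m - \<alpha>\<close> is not truncated.
\<close>

definition diff_op :: "'b::finite mpoly \<Rightarrow> 'b mpoly \<Rightarrow> 'b mpoly" where
  "diff_op q p = (\<Sum>\<alpha>\<in>Poly_Mapping.keys q. \<Sum>m\<in>Poly_Mapping.keys p.
     Poly_Mapping.single (m - \<alpha>) (Poly_Mapping.lookup q \<alpha> * Poly_Mapping.lookup p m *
       of_nat (\<Prod>a\<in>UNIV. fact (Poly_Mapping.lookup \<alpha> a) * (Poly_Mapping.lookup m a choose Poly_Mapping.lookup \<alpha> a))))"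

text \<open>For series encoded as above the sum is finite: \<open>F $ k\<close> has degree \<open>k\<close>, so it annihilates \<open>p\<close>
  once \<open>k\<close> exceeds the degree of \<open>p\<close>.\<close>

definition diff_op_series :: "'b::finite mpoly fps \<Rightarrow> 'b mpoly \<Rightarrow> 'b mpoly" where
  "diff_op_series F p = Sum_any (\<lambda>k. diff_op (F $ k) p)"

definition Duflo :: "'b::lie_basis mpoly \<Rightarrow> 'b uea" where
  "Duflo p = Sym (diff_op_series (duflo_J_sqrt TYPE('b)) p)"

fun sqrt_coeff :: "'a::comm_ring_1 \<Rightarrow> 'a fps \<Rightarrow> nat \<Rightarrow> 'a" where
  "sqrt_coeff h J n =
     (if n = 0 then 1
      else h * (J $ n - (\<Sum>i\<in>{1..<n}. if i < n \<and> n - i < n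
                 then sqrt_coeff h J i * sqrt_coeff h J (n - i) else 0)))"

declare sqrt_coeff.simps [simp del]

lemma fps_square_nth:
  fixes F :: "'a::comm_ring_1 fps"
  assumes "F $ 0 = 1" and "n > 0"
  shows "(F ^ 2) $ n = 2 * F $ n + (\<Sum>i\<in>{1..<n}. F $ i * F $ (n - i))"
proof -
  have "{0..n} = insert 0 (insert n {1..<n})"
    using assms(2) by auto
  then show ?thesis
    using assms by (simp add: power2_eq_square fps_mult_nth)
qed

lemma fps_sqrt_ex1:
  fixes J :: "'a::comm_ring_1 fps" and h :: 'a
  assumes h: "2 * h = 1" and J: "J $ 0 = 1"
  shows "\<exists>!F. F $ 0 = 1 \<and> F ^ 2 = J"
proof
  define F where "F = Abs_fps (sqrt_coeff h J)"
  have F0: "F $ 0 = 1"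
    by (simp add: F_def sqrt_coeff.simps)
  have "(F ^ 2) $ n = J $ n" for n
  proof (cases "n = 0")
    case True
    then show ?thesis
      using F0 J by (simp add: power2_eq_square)
  next
    case False
    have "F $ n = h * (J $ n - (\<Sum>i\<in>{1..<n}. F $ i * F $ (n - i)))"
      using False unfolding F_def fps_nth_Abs_fps
      by (subst sqrt_coeff.simps) (auto intro!: arg_cong[where f = "(*) h"] sum.cong)
    then have "2 * F $ n = J $ n - (\<Sum>i\<in>{1..<n}. F $ i * F $ (n - i))"
      using h by (metis mult.assoc mult_1)
    then show ?thesis
      using False F0 by (simp add: fps_square_nth)
  qed
  then show "F $ 0 = 1 \<and> F ^ 2 = J"
    using F0 by (simp add: fps_eq_iff)
  fix G
  assume G: "G $ 0 = 1 \<and> G ^ 2 = J"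
  have "G $ n = F $ n" for n
  proof (induction n rule: less_induct)
    case (less n)
    show ?case
    proof (cases "n = 0")
      case False
      have "(\<Sum>i\<in>{1..<n}. G $ i * G $ (n - i)) = (\<Sum>i\<in>{1..<n}. F $ i * F $ (n - i))"
        by (rule sum.cong) (auto simp: less)
      moreover have "(G ^ 2) $ n = (F ^ 2) $ n"
        using G \<open>\<And>n. (F ^ 2) $ n = J $ n\<close> by simp
      moreover have "(G ^ 2) $ n = 2 * G $ n + (\<Sum>i\<in>{1..<n}. G $ i * G $ (n - i))"
        "(F ^ 2) $ n = 2 * F $ n + (\<Sum>i\<in>{1..<n}. F $ i * F $ (n - i))"
        using False F0 G fps_square_nth by blast+
      ultimately have "2 * G $ n = 2 * F $ n"
        by (metis add_right_cancel)
      then have "h * 2 * G $ n = h * 2 * F $ n"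
        by (simp add: mult.assoc)
      then show ?thesis
        using h by (simp add: mult.commute)
    qed (simp add: F0 G)
  qed
  then show "G = F"
    by (simp add: fps_eq_iff)
qed

lemma sinhc_half_nth:
  "sinhc_half $ k = (if even k then 1 / (2 ^ k * fact (k + 1)) else 0)"
proof -
  have "fps_exp (1/2 :: complex) - fps_exp (- 1/2)
      = fps_X * fps_shift 1 (fps_exp (1/2) - fps_exp (- 1/2))"
    by (rule fps_ext) simp
  then have shift: "sinhc_half = fps_shift 1 (fps_exp (1/2) - fps_exp (- 1/2))"
    unfolding sinhc_half_def by (metis fps_X_neq_zero nonzero_mult_div_cancel_left)
  have "sinhc_half $ k = ((1/2) ^ (k + 1) - (- (1/2)) ^ (k + 1)) / fact (k + 1)"
    unfolding shift by (simp add: diff_divide_distrib del: power_Suc fact_Suc)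
  moreover have "(- (1/2 :: complex)) ^ (k + 1) = (if even k then - 1 else 1) * (1/2) ^ (k + 1)"
    by (cases "even k") (simp_all only: power_minus_odd power_minus_even even_Suc Suc_eq_plus1[symmetric]
        if_True if_False mult_1 mult_minus1 simp_thms)
  ultimately show ?thesis
    by (simp add: power_one_over)
qed

lemma duflo_J_nth_0: "duflo_J T $ 0 = 1"
proof -
  have prod0: "(\<Prod>i\<in>A. f i) $ 0 = (\<Prod>i\<in>A. f i $ 0)" for f :: "'b \<Rightarrow> 'a mpoly fps" and A
    by (induction A rule: infinite_finite_induct) simp_all
  have sum0: "(\<Sum>i\<in>A. f i) $ 0 = (\<Sum>i\<in>A. f i $ 0)" for f :: "('a \<Rightarrow> 'a) \<Rightarrow> 'a mpoly fps" and A
    by (simp add: fps_sum_nth)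
  have sgn0: "(of_int z :: 'a mpoly fps) $ 0 = of_int z" for z
    by (simp add: fps_of_int[symmetric])
  have one: "mconst 1 = (1 :: 'a mpoly)"
    by (simp add: mconst_def)
  have "duflo_J T $ 0 = det (mat 1 :: 'a mpoly ^ 'a::lie_basis ^ 'a::lie_basis)"
    unfolding duflo_J_def det_def sum0
    by (simp add: prod0 sgn0 sinhc_half_nth one)
  then show ?thesis
    by simp
qed

lemma duflo_J_sqrt: "duflo_J_sqrt T $ 0 = 1" "duflo_J_sqrt T ^ 2 = duflo_J T"
proof -
  have "2 * mconst (1/2) = (mconst 1 :: 'a mpoly)"
    by (simp add: mconst_def mult_2 flip: single_add)
  then have "2 * mconst (1/2) = (1 :: 'a mpoly)"
    by (simp add: mconst_def)
  from theI'[OF fps_sqrt_ex1[OF this duflo_J_nth_0[of T]]]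
  show "duflo_J_sqrt T $ 0 = 1" "duflo_J_sqrt T ^ 2 = duflo_J T"
    unfolding duflo_J_sqrt_def by simp_all
qed

section \<open>The Lie algebra \<open>gl\<^sub>n\<close>\<close>

text \<open>\<open>n = CARD('n)\<close>, and \<open>E i j\<close> is the matrix unit with \<open>1\<close> in position \<open>(i, j)\<close>.\<close>

datatype 'n gl_basis = E 'n 'n

lemma UNIV_gl_basis: "UNIV = (\<lambda>(i, j). E i j) ` UNIV"
  by (auto simp: image_iff) (metis gl_basis.exhaust)

instantiation gl_basis :: (finite) lie_basis
begin

fun lie_sc_gl_basis :: "'a gl_basis \<Rightarrow> 'a gl_basis \<Rightarrow> 'a gl_basis \<Rightarrow> complex" where
  "lie_sc_gl_basis (E i j) (E k l) c =
     (if j = k then of_bool (c = E i l) else 0) - (if i = l then of_bool (c = E k j) else 0)"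

instance
proof
  show "finite (UNIV :: 'a gl_basis set)"
    by (subst UNIV_gl_basis) simp
next
  fix a b c :: "'a gl_basis"
  show "lie_sc a b c = - lie_sc b a c"
    by (cases a; cases b) simp
next
  have fin: "finite (UNIV :: 'a gl_basis set)"
    by (subst UNIV_gl_basis) simp
  have contract: "(\<Sum>d\<in>UNIV. lie_sc (E i j) (E k l) d * f d)
      = (if j = k then f (E i l) else 0) - (if i = l then f (E k j) else 0)"
    for i j k l :: 'a and f
    by (simp add: left_diff_distrib sum_subtractf of_bool_def if_distrib[of "\<lambda>x. x * _"] fin
        cong: if_cong)
  fix a b c e :: "'a gl_basis"
  show "(\<Sum>d\<in>UNIV. lie_sc a b d * lie_sc d c e + lie_sc b c d * lie_sc d a e
      + lie_sc c a d * lie_sc d b e) = 0"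
  proof (cases a; cases b; cases c)
    fix i j k l p q
    assume eqs: "a = E i j" "b = E k l" "c = E p q"
    show ?thesis
      unfolding eqs sum.distrib contract
      by (cases "j = k"; cases "l = i"; cases "l = p"; cases "q = k"; cases "q = i"; cases "j = p")
        simp_all
  qed
qed

end

section \<open>Column determinants\<close>

definition col_det :: "'a::ring_1 ^ 'n::{finite,linorder} ^ 'n::{finite,linorder} \<Rightarrow> 'a" where
  "col_det M = (\<Sum>\<sigma> | \<sigma> permutes UNIV.
     of_int (sign \<sigma>) * prod_list (map (\<lambda>j. M $h \<sigma> j $h j) (sorted_list_of_set UNIV)))"

definition diag_matrix :: "('n \<Rightarrow> 'a::zero) \<Rightarrow> 'a ^ 'n ^ 'n" where
  "diag_matrix d = (\<chi> i j. if i = j then d i else 0)"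

end

theory Submission
  imports Defs "HOL-Computational_Algebra.Polynomial" "HOL-Combinatorics.Multiset_Permutations"
begin

text \<open>
  Write \<open>n\<close> for \<open>CARD('n)\<close>, \<open>g(z) = sinh(z/2) / (z/2)\<close>, and \<open>b k\<close> for the coefficient of \<open>z\<^sup>k\<close> in
  \<open>g(z)\<close> to the power \<open>-(n + 1)\<close>. Let \<open>P k\<close> be the sum of the principal minors of size \<open>n - k\<close>
  of the matrix of generators. Both sides of the theorem turn out to be
  \<open>\<Sum>k. b k * k! * Sym (P k)\<close>; expanding minors, each side becomes a sum over permutations \<open>\<pi>\<close>
  and sets \<open>T\<close> of rows such that \<open>\<pi>\<close> is the identity off \<open>T\<close>.

  \<^bold>\<open>The Duflo side.\<close> A constant-coefficient operator \<open>q(\<partial>)\<close> acts on the determinant only through the class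
  of \<open>q\<close> modulo the annihilator \<open>{q. \<forall>r. (q r)(\<partial>) det = 0}\<close>, that is, through its image in the apolar
  algebra of the determinant. In that quotient the coordinates satisfy \<open>x\<^sub>i\<^sub>j x\<^sub>k\<^sub>l = - x\<^sub>i\<^sub>l x\<^sub>k\<^sub>j\<close>, as though
  \<open>x\<^sub>i\<^sub>j\<close> were a product \<open>e\<^sub>i f\<^sub>j\<close> of anticommuting variables. With \<open>\<tau>\<close> the trace, this gives
  \<open>ad\<^sup>3 = \<tau>\<^sup>2 ad\<close> and \<open>tr (ad\<^sup>2) = - 2 (n + 1) \<tau>\<^sup>2\<close>, and Jacobi's formula for the derivative of a determinant
  yields \<open>J(s x) * g(s \<tau>)\<close>\<open>\<^sup>2\<^sup>(\<^sup>n\<^sup>+\<^sup>1\<^sup>) = 1\<close> (lemma \<open>ap_fps_duflo_J\<close>). So the degree \<open>k\<close> part of the square root of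
  \<open>J\<close> acts on the determinant as \<open>b k * \<tau>\<^sup>k\<close>, and \<open>\<tau>\<^sup>k\<close> sends the determinant to \<open>k! * P k\<close>
  (lemma \<open>diff_op_trace_var_power\<close>).

  \<^bold>\<open>The column determinant.\<close> The Capelli shifts make the column determinant alternating in its columns
  (lemma \<open>row_antisym_permutes\<close>), so \<open>n!\<close> times it is the signed sum over all column orders. This turns it into
  a sum over all orderings of the rows, and expanding the diagonal shifts \<open>s\<^sub>i = (n - 1)/2 - i\<close> produces
  symmetrized minors weighted by the coefficients of \<open>\<Prod>i. (x + s\<^sub>i)\<close> (lemma \<open>shifted_perm_sum\<close>).

  \<^bold>\<open>The comparison.\<close> It remains to see that \<open>n! * (\<Sum>k. b k * x\<close>\<open>\<^sup>n\<^sup>-\<^sup>k / (n - k)!) = \<Prod>i<n. (x + (n - 1)/2 - i)\<close>,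
  which is a classical identity for generalized Bernoulli polynomials (lemma \<open>norlund_product\<close>).
\<close>

section \<open>An identity for generalized Bernoulli polynomials\<close>

text \<open>
  The series \<open>h(z) = (1 - exp (- z)) / z\<close>, the inverse of the Todd series; it equals
  \<open>g(z) * exp (- z/2)\<close> for \<open>g = sinhc_half\<close>.
\<close>

definition inverse_todd :: "complex fps" where
  "inverse_todd = fps_shift 1 (1 - fps_exp (- 1))"

lemma inverse_todd_X: "inverse_todd * fps_X = 1 - fps_exp (- 1)"
  unfolding inverse_todd_def by (rule fps_ext) simp

lemma inverse_todd_0: "inverse_todd $ 0 = 1"
  by (simp add: inverse_todd_def)

lemma inverse_todd_deriv:
  "inverse_todd + fps_X * fps_deriv inverse_todd = fps_exp (- 1)"
proof -
  have "fps_deriv (inverse_todd * fps_X) = fps_deriv (1 - fps_exp (- 1))"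
    by (simp add: inverse_todd_X)
  moreover have "fps_const (- 1) = (- 1 :: complex fps)"
    by (simp flip: fps_const_neg)
  ultimately show ?thesis
    by (simp add: algebra_simps)
qed

lemma sinhc_half_X: "sinhc_half * fps_X = fps_exp (1/2) - fps_exp (- 1/2)"
  by (rule fps_ext)
     (auto simp: sinhc_half_nth power_minus' power_divide field_simps fact_reduce elim!: oddE evenE)

lemma sinhc_half_eq: "sinhc_half = inverse_todd * fps_exp (1/2)"
proof -
  have "(inverse_todd * fps_exp (1/2)) * fps_X = fps_exp (1/2) * (1 - fps_exp (- 1))"
    unfolding inverse_todd_X[symmetric] by (simp only: ac_simps)
  also have "\<dots> = sinhc_half * fps_X"
    by (simp add: sinhc_half_X right_diff_distrib flip: fps_exp_add_mult)
  finally have "sinhc_half * fps_X = (inverse_todd * fps_exp (1/2)) * fps_X" by simp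
  then show ?thesis
    by (metis fps_X_neq_zero mult_right_cancel)
qed

text \<open>
  Since \<open>exp (- z) = h + z h'\<close>, the product \<open>N h\<close>\<open>\<^sup>-\<^sup>(\<^sup>N\<^sup>+\<^sup>1\<^sup>) exp (- z) exp (y z)\<close> equals
  \<open>N Q + z (y Q - Q')\<close> with \<open>Q = h\<close>\<open>\<^sup>-\<^sup>N exp (y z)\<close>; in degree \<open>N\<close> the terms \<open>N Q\<close> and \<open>z Q'\<close> cancel.
  Here \<open>N = Suc n\<close>.
\<close>

lemma inverse_todd_step:
  fixes y :: complex
  shows "of_nat (Suc n) * (inverse inverse_todd ^ Suc (Suc n) * fps_exp (- 1) * fps_exp y) $ Suc n
    = y * (inverse inverse_todd ^ Suc n * fps_exp y) $ n"
proof -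
  define k where "k = inverse inverse_todd"
  define h' where "h' = fps_deriv inverse_todd"
  define Q where "Q = k ^ Suc n * fps_exp y"
  have kh: "k * inverse_todd = 1"
    unfolding k_def by (rule inverse_mult_eq_1) (simp add: inverse_todd_0)
  have k': "fps_deriv k = - h' * k ^ 2"
    unfolding k_def h'_def by (rule fps_inverse_deriv) (simp add: inverse_todd_0)
  have "fps_deriv (k ^ Suc n) = of_nat (Suc n) * (- h' * k ^ 2) * k ^ n"
    using fps_deriv_power'[of k "Suc n"] by (simp only: k' diff_Suc_1)
  then have Q': "fps_deriv Q = fps_const y * Q - of_nat (Suc n) * (h' * k ^ Suc (Suc n) * fps_exp y)"
    unfolding Q_def fps_deriv_mult
    by (simp add: power2_eq_square algebra_simps del: of_nat_Suc)
  have "k ^ Suc (Suc n) * fps_exp (- 1) * fps_exp y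
      = (k * inverse_todd) * Q + fps_X * (h' * k ^ Suc (Suc n) * fps_exp y)"
    unfolding inverse_todd_deriv[symmetric] Q_def h'_def by (simp add: algebra_simps)
  then have "of_nat (Suc n) * (k ^ Suc (Suc n) * fps_exp (- 1) * fps_exp y)
      = of_nat (Suc n) * Q + fps_X * (fps_const y * Q - fps_deriv Q)"
    unfolding kh Q' by (simp add: algebra_simps)
  then have "(of_nat (Suc n) * (k ^ Suc (Suc n) * fps_exp (- 1) * fps_exp y)) $ Suc n = y * Q $ n"
    by (simp add: fps_of_nat[symmetric] del: of_nat_Suc)
  then show ?thesis
    by (simp add: k_def Q_def fps_of_nat[symmetric] del: of_nat_Suc)
qed

text \<open>
  The left-hand side is the generalized Bernoulli polynomial of degree \<open>n\<close> and order \<open>n + 1\<close>, centred at its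
  point of symmetry. At this order its zeros form an arithmetic progression.
\<close>

theorem norlund_product:
  fixes x :: complex
  shows "fact n * (inverse sinhc_half ^ Suc n * fps_exp x) $ n
    = (\<Prod>i<n. x + (of_nat n - 1) / 2 - of_nat i)"
proof (induction n arbitrary: x)
  case 0
  show ?case by (simp add: sinhc_half_nth)
next
  case (Suc n)
  have inv: "inverse sinhc_half = inverse inverse_todd * fps_exp (- 1/2)"
    by (simp add: sinhc_half_eq fps_inverse_mult flip: fps_exp_neg)
  have pw: "inverse sinhc_half ^ m * fps_exp z
      = inverse inverse_todd ^ m * fps_exp (z - of_nat m / 2)" for m z
    by (simp add: inv power_mult_distrib fps_exp_power_mult mult.assoc flip: fps_exp_add_mult)
  have "(inverse sinhc_half ^ Suc (Suc n) * fps_exp x)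
     = inverse inverse_todd ^ Suc (Suc n) * fps_exp (- 1) * fps_exp (x - of_nat n / 2)"
    unfolding pw by (simp add: mult.assoc flip: fps_exp_add_mult) (simp add: field_simps)
  moreover have "inverse inverse_todd ^ Suc n * fps_exp (x - of_nat n / 2)
    = inverse sinhc_half ^ Suc n * fps_exp (x + 1/2)"
    unfolding pw by (simp add: field_simps)
  ultimately have "of_nat (Suc n) * (inverse sinhc_half ^ Suc (Suc n) * fps_exp x) $ Suc n
     = (x - of_nat n / 2) * (inverse sinhc_half ^ Suc n * fps_exp (x + 1/2)) $ n"
    using inverse_todd_step[of n "x - of_nat n / 2"] by simp
  then have "fact (Suc n) * (inverse sinhc_half ^ Suc (Suc n) * fps_exp x) $ Suc n
     = (x - of_nat n / 2) * (fact n * (inverse sinhc_half ^ Suc n * fps_exp (x + 1/2)) $ n)"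
    unfolding fact_Suc of_nat_mult of_nat_id by (metis mult.assoc mult.commute)
  also have "\<dots> = (x - of_nat n / 2) * (\<Prod>i<n. x + 1/2 + (of_nat n - 1) / 2 - of_nat i)"
    unfolding Suc.IH ..
  also have "\<dots> = (\<Prod>i<Suc n. x + (of_nat (Suc n) - 1) / 2 - of_nat i)"
  proof -
    have "x + (of_nat (Suc n) - 1) / 2 - of_nat i = x + 1/2 + (of_nat n - 1) / 2 - of_nat i" for i
      by (simp add: field_simps)
    moreover have "x + 1/2 + (of_nat n - 1) / 2 - of_nat n = x - of_nat n / 2"
      by (simp add: field_simps)
    ultimately show ?thesis by (simp only: prod.lessThan_Suc mult.commute)
  qed
  finally show ?case .
qed

corollary norlund_coeff:
  assumes "m \<le> n"
  shows "fact n * (inverse sinhc_half ^ Suc n) $ (n - m)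
    = fact m * poly.coeff (\<Prod>i<n. [:(of_nat n - 1) / 2 - of_nat i, 1:]) m"
proof -
  define b where "b = inverse sinhc_half ^ Suc n"
  define p where "p = (\<Sum>j\<le>n. monom (fact n * b $ (n - j) / fact j) j)"
  have "poly p x = poly (\<Prod>i<n. [:(of_nat n - 1) / 2 - of_nat i, 1:]) x" for x :: complex
  proof -
    have "poly p x = fact n * (fps_exp x * b) $ n"
      by (simp add: p_def poly_sum poly_monom fps_mult_nth sum_distrib_left atLeast0AtMost)
         (rule sum.cong, auto simp: field_simps)
    then show ?thesis
      using norlund_product[of n x] unfolding b_def
      by (simp add: poly_prod mult.commute add_diff_eq add.commute)
  qed
  then have "p = (\<Prod>i<n. [:(of_nat n - 1) / 2 - of_nat i, 1:])"
    using poly_eq_poly_eq_iff by blast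
  moreover have "poly.coeff p m = fact n * b $ (n - m) / fact m"
    unfolding p_def coeff_sum coeff_monom using assms by simp
  ultimately show ?thesis
    by (simp add: b_def field_simps)
qed

section \<open>Scalars and linearity of the symmetrization map\<close>

lemma poly_mapping_induct_add [case_names single add]:
  assumes single: "\<And>k v. P (Poly_Mapping.single k v)"
    and add: "\<And>p q. P p \<Longrightarrow> P q \<Longrightarrow> P (p + q)"
  shows "P (p :: 'a \<Rightarrow>\<^sub>0 'b::comm_monoid_add)"
proof -
  have *: "P (\<Sum>k\<in>A. Poly_Mapping.single k (Poly_Mapping.lookup p k))" if "finite A" for A
    using that single[of undefined 0] by induction (simp_all add: single add)
  then show ?thesis
  proof -
    have "p = (\<Sum>k\<in>Poly_Mapping.keys p. Poly_Mapping.single k (Poly_Mapping.lookup p k))"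
      by (rule poly_mapping_eqI) (auto simp: lookup_sum lookup_single when_def in_keys_iff)
    then show ?thesis using * finite_keys by metis
  qed
qed

lemma uconst_0 [simp]: "uconst 0 = (0 :: 'b::lie_basis uea)"
  by transfer (simp add: fconst_def equivp_reflp[OF equivp_lie_cong])

lemma uconst_1 [simp]: "uconst 1 = (1 :: 'b::lie_basis uea)"
  by transfer (simp add: fconst_def equivp_reflp[OF equivp_lie_cong])

lemma uconst_add: "uconst (c + d) = (uconst c + uconst d :: 'b::lie_basis uea)"
  by transfer (simp add: fconst_def single_add equivp_reflp[OF equivp_lie_cong])

lemma uconst_mult: "uconst (c * d) = (uconst c * uconst d :: 'b::lie_basis uea)"
  by transfer (simp add: fconst_def mult_single equivp_reflp[OF equivp_lie_cong])

lemma uconst_uminus: "uconst (- c) = (- uconst c :: 'b::lie_basis uea)"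
  using uconst_add[of c "- c", where 'b='b] by (simp add: eq_neg_iff_add_eq_0 add.commute)

lemma uconst_diff: "uconst (c - d) = (uconst c - uconst d :: 'b::lie_basis uea)"
  using uconst_add[of c "- d", where 'b='b] by (simp add: uconst_uminus)

lemma uconst_of_int: "uconst (of_int z) = (of_int z :: 'b::lie_basis uea)"
  by (induction z rule: int_induct[where k = 0]) (simp_all add: uconst_add uconst_diff)

lemma uconst_of_nat: "uconst (of_nat z) = (of_nat z :: 'b::lie_basis uea)"
  using uconst_of_int[of "int z"] by simp

lemma uconst_sum: "uconst (sum f A) = (\<Sum>a\<in>A. uconst (f a) :: 'b::lie_basis uea)"
  by (induction A rule: infinite_finite_induct) (simp_all add: uconst_add)

lemma fconst_central: "fconst c * p = p * (fconst c :: 'b free_alg)"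
proof (rule poly_mapping_eqI)
  fix w :: "'b word"
  show "Poly_Mapping.lookup (fconst c * p) w = Poly_Mapping.lookup (p * fconst c) w"
  proof (induction p rule: poly_mapping_induct_add)
    case (single k v)
    then show ?case by (simp add: fconst_def mult_single mult.commute)
  next
    case (add p q)
    then show ?case by (simp add: distrib_left distrib_right lookup_add)
  qed
qed

lemma uconst_central: "uconst c * p = p * (uconst c :: 'b::lie_basis uea)"
  by transfer (simp add: fconst_central equivp_reflp[OF equivp_lie_cong])

lemma mult_uconst_left_commute: "p * (uconst c * q) = uconst c * (p * q :: 'b::lie_basis uea)"
  by (metis mult.assoc uconst_central)

lemma uconst_cancel:
  assumes "c \<noteq> 0" "uconst c * p = uconst c * (q :: 'b::lie_basis uea)"
  shows "p = q"
proof -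
  have "uconst (1 / c) * (uconst c * p) = uconst (1 / c) * (uconst c * q)" using assms by simp
  then show ?thesis
    unfolding mult.assoc[symmetric] uconst_mult[symmetric] using assms(1) by simp
qed

lemma Sym_superset:
  assumes "finite A" "Poly_Mapping.keys p \<subseteq> A"
  shows "Sym p = (\<Sum>m\<in>A. uconst (Poly_Mapping.lookup p m) * sym_product (monomial_factors m))"
  unfolding Sym_def using assms
  by (intro sum.mono_neutral_left) (auto simp: in_keys_iff)

lemma Sym_add: "Sym (p + q) = Sym p + Sym q"
proof -
  let ?A = "Poly_Mapping.keys p \<union> Poly_Mapping.keys q"
  have "Poly_Mapping.keys (p + q) \<subseteq> ?A" by (rule keys_add)
  then show ?thesis
    by (subst (1 2 3) Sym_superset[of ?A])
       (auto simp: lookup_add uconst_add distrib_right sum.distrib)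
qed

lemma mconst_mult_lookup: "Poly_Mapping.lookup (mconst c * p) m = c * Poly_Mapping.lookup p m"
proof (induction p rule: poly_mapping_induct_add)
  case (single k v)
  then show ?case by (simp add: mconst_def mult_single lookup_single when_def)
next
  case (add p q)
  then show ?case by (simp add: distrib_left lookup_add)
qed

lemma Sym_mconst_mult: "Sym (mconst c * p) = uconst c * Sym p"
proof -
  have "Poly_Mapping.keys (mconst c * p) \<subseteq> Poly_Mapping.keys p"
    by (auto simp: in_keys_iff mconst_mult_lookup)
  then show ?thesis
    by (subst Sym_superset[of "Poly_Mapping.keys p"])
       (auto simp: Sym_def mconst_mult_lookup uconst_mult mult.assoc sum_distrib_left)
qed

lemma Sym_sum: "Sym (sum f A) = (\<Sum>a\<in>A. Sym (f a))"
proof (induction A rule: infinite_finite_induct)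
  case empty
  show ?case by (simp add: Sym_def)
next
  case (infinite A)
  then show ?case by (simp add: Sym_def)
qed (simp add: Sym_add)

lemma mconst_0 [simp]: "mconst 0 = 0" and mconst_1 [simp]: "mconst 1 = 1"
  by (simp_all add: mconst_def)

lemma mconst_add: "mconst (c + d) = mconst c + mconst d"
  by (simp add: mconst_def single_add)

lemma mconst_mult: "mconst (c * d) = mconst c * mconst d"
  by (simp add: mconst_def mult_single)

lemma mconst_diff: "mconst (c - d) = mconst c - mconst d"
  by (simp add: mconst_def single_diff)

lemma mconst_of_int: "mconst (of_int z) = of_int z"
  by (induction z rule: int_induct[where k = 0]) (simp_all add: mconst_add mconst_diff)

lemma mconst_of_nat: "mconst (of_nat z) = of_nat z"
  using mconst_of_int[of "int z"] by simp

section \<open>Sums over orderings of a finite set\<close>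

lemma sum_permutations_of_set_Cons:
  assumes "finite A" "A \<noteq> {}"
  shows "(\<Sum>xs\<in>permutations_of_set A. f xs)
    = (\<Sum>x\<in>A. \<Sum>xs\<in>permutations_of_set (A - {x}). f (x # xs))"
proof -
  have "(\<Sum>xs\<in>permutations_of_set A. f xs)
      = (\<Sum>x\<in>A. sum f ((#) x ` permutations_of_set (A - {x})))"
    unfolding permutations_of_set_nonempty[OF assms(2)] using assms(1)
    by (intro sum.UNION_disjoint) auto
  then show ?thesis
    by (simp add: sum.reindex)
qed

lemma sum_subsets_remove:
  assumes "finite A"
  shows "(\<Sum>x\<in>A. \<Sum>T\<in>Pow (A - {x}). f x T) = (\<Sum>T\<in>Pow A. \<Sum>x\<in>A - T. f x T)"
  using assms by (subst (1 2) sum.Sigma) (auto intro!: sum.reindex_bij_witness[of _ "\<lambda>(T,x). (x,T)" "\<lambda>(x,T). (T,x)"])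

lemma sum_subsets_insert:
  assumes "finite A"
  shows "(\<Sum>x\<in>A. \<Sum>T\<in>Pow (A - {x}). f x T) = (\<Sum>T\<in>Pow A. \<Sum>x\<in>T. f x (T - {x}))"
  using assms finite_subset[of _ A] by (subst (1 2) sum.Sigma)
    (force intro!: sum.reindex_bij_witness[of _ "\<lambda>(T,x). (x,T - {x})" "\<lambda>(x,T). (insert x T,x)"]
      simp: Diff_insert_absorb)+

text \<open>
  The sum over all orderings of \<open>T\<close> of the ordered product of the elements \<open>a x\<close>.
\<close>

definition perm_sum :: "('q \<Rightarrow> 'u::ring_1) \<Rightarrow> 'q set \<Rightarrow> 'u" where
  "perm_sum a T = (\<Sum>xs\<in>permutations_of_set T. prod_list (map a xs))"

lemma perm_sum_rec:
  assumes "finite T" "T \<noteq> {}"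
  shows "perm_sum a T = (\<Sum>x\<in>T. a x * perm_sum a (T - {x}))"
  unfolding perm_sum_def sum_permutations_of_set_Cons[OF assms]
  by (simp add: sum_distrib_left)

lemma degree_prod_list_linear: "degree (\<Prod>s\<leftarrow>ss. [:s, 1 :: complex:]) \<le> length ss"
proof (induction ss)
  case (Cons s ss)
  have "degree ([:s, 1:] * (\<Prod>s\<leftarrow>ss. [:s, 1:])) \<le> degree [:s, 1:] + degree (\<Prod>s\<leftarrow>ss. [:s, 1:])"
    by (rule degree_mult_le)
  then show ?case using Cons by simp
qed simp

text \<open>
  Every ordering \<open>xs\<close> of \<open>A\<close> contributes the ordered product of the factors \<open>a x + s d x\<close>, where the scalar \<open>s\<close>
  depends only on the position and \<open>d x\<close> only on the letter. Choosing the summand \<open>a x\<close> exactly for the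
  letters in \<open>T\<close>, the positions of the other letters are arbitrary, which gives the elementary
  symmetric polynomial of degree \<open>|A - T|\<close> in the shifts, that is, a coefficient of \<open>\<Prod>s. (x + s)\<close>.
\<close>

lemma shifted_perm_sum:
  fixes a :: "'q \<Rightarrow> 'b::lie_basis uea" and d :: "'q \<Rightarrow> complex"
  assumes "finite A" "card A = length ss"
  shows "(\<Sum>xs\<in>permutations_of_set A.
      prod_list (map2 (\<lambda>x s. a x + uconst (s * d x)) xs ss))
    = (\<Sum>T\<in>Pow A. uconst ((\<Prod>x\<in>A - T. d x) * fact (card (A - T)) *
        poly.coeff (\<Prod>s\<leftarrow>ss. [:s, 1:]) (card T)) * perm_sum a T)"
  using assms
proof (induction ss arbitrary: A)
  case Nil
  then show ?case by (simp add: perm_sum_def)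
next
  case (Cons s ss)
  define p where "p = (\<Prod>s\<leftarrow>ss. [:s, 1:])"
  define F where "F B T = (\<Prod>x\<in>B - T. d x) * fact (card (B - T))" for B T
  have ne: "A \<noteq> {}" using Cons.prems by auto
  have fT: "finite T" if "T \<in> Pow A" for T using that Cons.prems finite_subset by auto
  have "(\<Sum>xs\<in>permutations_of_set A. prod_list (map2 (\<lambda>x s. a x + uconst (s * d x)) xs (s # ss)))
    = (\<Sum>x\<in>A. (a x + uconst (s * d x)) *
        (\<Sum>xs\<in>permutations_of_set (A - {x}). prod_list (map2 (\<lambda>x s. a x + uconst (s * d x)) xs ss)))"
    by (simp add: sum_permutations_of_set_Cons[OF Cons.prems(1) ne] sum_distrib_left)
  also have "\<dots> = (\<Sum>x\<in>A. (a x + uconst (s * d x)) *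
      (\<Sum>T\<in>Pow (A - {x}). uconst (F (A - {x}) T * poly.coeff p (card T)) * perm_sum a T))"
  proof (rule sum.cong[OF refl])
    fix x assume "x \<in> A"
    then have "card (A - {x}) = length ss" using Cons.prems by simp
    from Cons.IH[OF _ this] show "(a x + uconst (s * d x)) *
        (\<Sum>xs\<in>permutations_of_set (A - {x}). prod_list (map2 (\<lambda>x s. a x + uconst (s * d x)) xs ss))
      = (a x + uconst (s * d x)) *
        (\<Sum>T\<in>Pow (A - {x}). uconst (F (A - {x}) T * poly.coeff p (card T)) * perm_sum a T)"
      using Cons.prems(1) unfolding F_def p_def by simp
  qed
  \<comment> \<open>Choosing \<open>a x\<close> in the first position adds \<open>x\<close> to the set; choosing the scalar leaves it outside.\<close>
  also have "\<dots> = (\<Sum>x\<in>A. \<Sum>T\<in>Pow (A - {x}). uconst (F (A - {x}) T * poly.coeff p (card T)) * (a x * perm_sum a T))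
     + (\<Sum>x\<in>A. \<Sum>T\<in>Pow (A - {x}). uconst (s * d x * F (A - {x}) T * poly.coeff p (card T)) * perm_sum a T)"
  proof -
    have "(a x + uconst (s * d x)) * (uconst c * q) = uconst c * (a x * q) + uconst (s * d x * c) * q" for x c q
      by (simp only: distrib_right mult_uconst_left_commute[of "a x"]) (simp only: uconst_mult mult.assoc)
    then show ?thesis
      by (simp only: sum_distrib_left sum.distrib mult.assoc)
  qed
  also have "(\<Sum>x\<in>A. \<Sum>T\<in>Pow (A - {x}). uconst (F (A - {x}) T * poly.coeff p (card T)) * (a x * perm_sum a T))
     = (\<Sum>T\<in>Pow A. \<Sum>x\<in>T. uconst (F (A - {x}) (T - {x}) * poly.coeff p (card (T - {x}))) * (a x * perm_sum a (T - {x})))"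
    by (rule sum_subsets_insert) fact
  also have "\<dots> = (\<Sum>T\<in>Pow A. uconst (F A T * (case card T of 0 \<Rightarrow> 0 | Suc m \<Rightarrow> poly.coeff p m)) * perm_sum a T)"
  proof (rule sum.cong[OF refl])
    fix T assume T: "T \<in> Pow A"
    show "(\<Sum>x\<in>T. uconst (F (A - {x}) (T - {x}) * poly.coeff p (card (T - {x}))) * (a x * perm_sum a (T - {x})))
      = uconst (F A T * (case card T of 0 \<Rightarrow> 0 | Suc m \<Rightarrow> poly.coeff p m)) * perm_sum a T"
    proof (cases "T = {}")
      case False
      have "A - {x} - (T - {x}) = A - T" if "x \<in> T" for x using that by auto
      moreover have "card (T - {x}) = card T - 1" if "x \<in> T" for x using that fT[OF T] by simp
      moreover obtain m where "card T = Suc m" using False fT[OF T] by (cases "card T") auto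
      ultimately show ?thesis
        by (simp add: perm_sum_rec[OF fT[OF T] False] F_def sum_distrib_left)
    qed simp
  qed
  also have "(\<Sum>x\<in>A. \<Sum>T\<in>Pow (A - {x}). uconst (s * d x * F (A - {x}) T * poly.coeff p (card T)) * perm_sum a T)
     = (\<Sum>T\<in>Pow A. \<Sum>x\<in>A - T. uconst (s * d x * F (A - {x}) T * poly.coeff p (card T)) * perm_sum a T)"
    by (rule sum_subsets_remove) fact
  also have "\<dots> = (\<Sum>T\<in>Pow A. uconst (F A T * (s * poly.coeff p (card T))) * perm_sum a T)"
  proof (rule sum.cong[OF refl])
    fix T assume T: "T \<in> Pow A"
    have *: "d x * F (A - {x}) T * of_nat (card (A - T)) = F A T" if "x \<in> A - T" for x
    proof -
      have "A - {x} - T = (A - T) - {x}" by auto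
      moreover have "fact (card (A - T)) = of_nat (card (A - T)) * (fact (card (A - T) - 1) :: complex)"
        using that Cons.prems(1) by (intro fact_reduce) (auto simp: card_gt_0_iff)
      moreover have "(\<Prod>y\<in>A - T. d y) = d x * (\<Prod>y\<in>(A - T) - {x}. d y)"
        using that Cons.prems(1) by (intro prod.remove) auto
      ultimately show ?thesis using that Cons.prems(1) by (simp add: F_def)
    qed
    have "(\<Sum>x\<in>A - T. s * d x * F (A - {x}) T * poly.coeff p (card T)) = F A T * (s * poly.coeff p (card T))"
    proof (cases "A - T = {}")
      case False
      then have c: "card (A - T) > 0" using Cons.prems(1) by (simp add: card_gt_0_iff)
      have "(\<Sum>x\<in>A - T. s * d x * F (A - {x}) T * poly.coeff p (card T))
         = (\<Sum>x\<in>A - T. F A T / of_nat (card (A - T)) * (s * poly.coeff p (card T)))"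
        using c by (intro sum.cong refl) (auto simp: field_simps simp flip: *)
      then show ?thesis using c by simp
    next
      case True
      then have "card T = Suc (length ss)" using T Cons.prems by (simp add: subset_antisym)
      \<comment> \<open>No letter of \<open>A\<close> is left for the first position, but then the degree of \<open>p\<close> is too small.\<close>
      then have "poly.coeff p (card T) = 0"
        unfolding p_def using degree_prod_list_linear[of ss] by (intro coeff_eq_0) simp
      then show ?thesis by simp
    qed
    then show "(\<Sum>x\<in>A - T. uconst (s * d x * F (A - {x}) T * poly.coeff p (card T)) * perm_sum a T)
      = uconst (F A T * (s * poly.coeff p (card T))) * perm_sum a T"
      by (simp only: flip: uconst_sum sum_distrib_right[where r = "perm_sum a T"])
  qed
  also have "(\<Sum>T\<in>Pow A. uconst (F A T * (case card T of 0 \<Rightarrow> 0 | Suc m \<Rightarrow> poly.coeff p m)) * perm_sum a T)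
      + (\<Sum>T\<in>Pow A. uconst (F A T * (s * poly.coeff p (card T))) * perm_sum a T)
    = (\<Sum>T\<in>Pow A. uconst (F A T * poly.coeff ([:s, 1:] * p) (card T)) * perm_sum a T)"
    by (simp add: coeff_pCons uconst_add uconst_mult distrib_left distrib_right sum.distrib add.commute split: nat.splits)
  finally show ?case by (simp add: F_def p_def)
qed

section \<open>The column determinant is alternating\<close>

lemma alternating_of_adjacent:
  fixes H :: "('n::{finite,linorder} \<Rightarrow> 'n) \<Rightarrow> 'u::ring_1" and L :: "'n list"
  assumes L: "distinct L" "set L = UNIV"
    and adj: "\<And>\<tau> i. Suc i < length L \<Longrightarrow> H (\<tau> \<circ> Transposition.transpose (L ! i) (L ! Suc i)) = - H \<tau>"
    and \<tau>: "\<tau> permutes UNIV"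
  shows "H \<tau> = of_int (sign \<tau>) * H id"
proof -
  \<comment> \<open>A transposition of positions at distance \<open>d + 1\<close> is one at distance \<open>d\<close> conjugated by an adjacent one.\<close>
  have swap: "H (\<tau> \<circ> Transposition.transpose (L ! i) (L ! j)) = - H \<tau>" if "i < j" "j < length L" for i j \<tau>
    using that
  proof (induction j arbitrary: \<tau>)
    case (Suc j)
    show ?case
    proof (cases "i = j")
      case True
      then show ?thesis using adj[of j \<tau>] Suc.prems by (simp only: True)
    next
      case False
      then have ij: "i < j" using Suc.prems by simp
      have ne: "L ! i \<noteq> L ! j" "L ! i \<noteq> L ! Suc j" "L ! j \<noteq> L ! Suc j"
        using L(1) Suc.prems ij by (auto simp: nth_eq_iff_index_eq)
      define u where "u = Transposition.transpose (L ! j) (L ! Suc j)"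
      have "Transposition.transpose (L ! i) (L ! Suc j) = u \<circ> Transposition.transpose (L ! i) (L ! j) \<circ> u"
        unfolding u_def using ne by (auto simp: fun_eq_iff Transposition.transpose_def)
      then have "H (\<tau> \<circ> Transposition.transpose (L ! i) (L ! Suc j))
          = H (((\<tau> \<circ> u) \<circ> Transposition.transpose (L ! i) (L ! j)) \<circ> u)"
        by (simp add: comp_assoc)
      also have "\<dots> = - H ((\<tau> \<circ> u) \<circ> Transposition.transpose (L ! i) (L ! j))"
        unfolding u_def by (rule adj) (use Suc.prems in simp)
      also have "\<dots> = H (\<tau> \<circ> u)"
        by (subst Suc.IH) (use ij Suc.prems in simp_all)
      also have "\<dots> = - H \<tau>"
        unfolding u_def by (rule adj) (use Suc.prems in simp)
      finally show ?thesis .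
    qed
  qed simp
  have swap': "H (\<tau> \<circ> Transposition.transpose a b) = - H \<tau>" if "a \<noteq> b" for a b \<tau>
  proof -
    obtain i j where ij: "i < length L" "j < length L" "a = L ! i" "b = L ! j"
      using L(2) by (metis UNIV_I in_set_conv_nth)
    then have "i < j \<or> j < i" using that by (metis linorder_neq_iff)
    then show ?thesis
      using swap[of i j \<tau>] swap[of j i \<tau>] ij by (auto simp: transpose_commute)
  qed
  have "\<forall>\<rho>. H (\<rho> \<circ> \<tau>) = of_int (sign \<tau>) * H \<rho>"
    using \<tau> finite
  proof (induction rule: permutes_induct)
    case (swap a b p)
    let ?t = "Transposition.transpose a b"
    have "sign (?t \<circ> p) = - sign p"
      using swap by (simp add: sign_compose sign_swap_id permutation_swap_id permutes_imp_permutation[OF finite])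
    moreover have "H (\<rho> \<circ> (?t \<circ> p)) = - (of_int (sign p) * H \<rho>)" for \<rho>
    proof -
      have "H (\<rho> \<circ> (?t \<circ> p)) = of_int (sign p) * H (\<rho> \<circ> ?t)"
        using swap.IH by (simp only: flip: comp_assoc)
      then show ?thesis using swap'[OF \<open>a \<noteq> b\<close>] by simp
    qed
    ultimately show ?case by (simp only: of_int_minus mult_minus_left simp_thms)
  qed (simp add: sign_id)
  then show ?thesis by (metis id_comp)
qed

text \<open>
  The entry in row \<open>\<sigma> p\<close> and column \<open>\<tau> p\<close> of the matrix of generators, with the diagonal shifted by a scalar that
  depends on the position \<open>p\<close> of the factor instead of on the column.
\<close>

definition shifted_entry :: "('n \<Rightarrow> complex) \<Rightarrow> ('n \<Rightarrow> 'n) \<Rightarrow> ('n \<Rightarrow> 'n) \<Rightarrow> 'n::finite \<Rightarrow> 'n gl_basis uea" where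
  "shifted_entry s \<sigma> \<tau> p = uvar (E (\<sigma> p) (\<tau> p)) + uconst (s p * of_bool (\<sigma> p = \<tau> p))"

lemma uvar_E_commutator:
  "uvar (E i j) * uvar (E k l) - uvar (E k l) * uvar (E i j) =
    uconst (of_bool (j = k)) * uvar (E i l) - uconst (of_bool (i = l)) * uvar (E k j)"
proof -
  have "(\<Sum>c\<in>UNIV. uconst (lie_sc (E i j) (E k l) c) * uvar c)
     = (\<Sum>c\<in>UNIV. uconst (of_bool (j = k)) * (if c = E i l then uvar c else 0))
       - (\<Sum>c\<in>UNIV. uconst (of_bool (i = l)) * (if c = E k j then uvar c else 0))"
    unfolding sum_subtractf[symmetric]
    by (rule sum.cong) (auto simp: uconst_diff algebra_simps)
  then show ?thesis
    unfolding uvar_commutator by (simp flip: sum_distrib_left)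
qed

text \<open>
  The heart of the Capelli identity: consecutive factors whose shifts differ by one satisfy
  this relation, because the scalar correction cancels the commutators. The two row indices are
  antisymmetrized and the two column indices are symmetrized.
\<close>

lemma shifted_pair:
  fixes u :: complex
  defines "e v i j \<equiv> uvar (E i j) + uconst (v * of_bool (i = j))"
  shows "e (u + 1) i j * e u k l - e (u + 1) k j * e u i l
       + e (u + 1) i l * e u k j - e (u + 1) k l * e u i j = 0"
proof -
  have ex: "e v a b * e w c d = uvar (E a b) * uvar (E c d)
     + uconst (w * of_bool (c = d)) * uvar (E a b) + uconst (v * of_bool (a = b)) * uvar (E c d)
     + uconst (v * w * of_bool (a = b \<and> c = d))" for v w a b c d
    unfolding e_def distrib_left distrib_right
    by (simp add: uconst_central[symmetric, where p = "uvar x" for x] of_bool_conj add_ac mult_ac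
        flip: uconst_mult)
  have "uvar (E i j) * uvar (E k l) = uvar (E k l) * uvar (E i j) +
    uconst (of_bool (j = k)) * uvar (E i l) - uconst (of_bool (i = l)) * uvar (E k j)"
    "uvar (E i l) * uvar (E k j) = uvar (E k j) * uvar (E i l) +
    uconst (of_bool (l = k)) * uvar (E i j) - uconst (of_bool (i = j)) * uvar (E k l)"
    using uvar_E_commutator[of i j k l] uvar_E_commutator[of i l k j] by (simp_all add: algebra_simps)
  then show ?thesis
    unfolding ex
    by (cases "j = k"; cases "i = l"; cases "l = k"; cases "i = j")
       (simp_all add: uconst_add distrib_right algebra_simps)
qed

lemma two_uea_cancel: "2 * (x :: 'b::lie_basis uea) = 0 \<Longrightarrow> x = 0"
  using uconst_cancel[of 2 x 0] uconst_of_nat[of 2, where 'b='b] by simp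

text \<open>
  The determinant of the shifted matrix with its columns taken in the order prescribed by \<open>\<tau>\<close>, the factors being
  ordered by the list \<open>L\<close> of positions.
\<close>

definition row_antisym :: "('n \<Rightarrow> complex) \<Rightarrow> 'n list \<Rightarrow> ('n \<Rightarrow> 'n) \<Rightarrow> 'n::finite gl_basis uea" where
  "row_antisym s L \<tau> = (\<Sum>\<sigma> | \<sigma> permutes UNIV.
     of_int (sign \<sigma>) * prod_list (map (shifted_entry s \<sigma> \<tau>) L))"

lemma row_antisym_swap:
  fixes L :: "'n::finite list"
  assumes L: "distinct L" "L = U @ a # b # V" and s: "s a = s b + 1"
  shows "row_antisym s L (\<tau> \<circ> Transposition.transpose a b) = - row_antisym s L \<tau>"
proof -
  define t where "t = Transposition.transpose a b"
  define w where "w \<sigma> \<tau> = prod_list (map (shifted_entry s \<sigma> \<tau>) L)" for \<sigma> \<tau>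
  have ab: "a \<noteq> b" using L by auto
  have t: "t permutes UNIV" unfolding t_def by (simp add: permutes_swap_id)
  have tt: "t a = b" "t b = a" "\<And>p. p \<in> set U \<union> set V \<Longrightarrow> t p = p"
    using L by (auto simp: t_def Transposition.transpose_def)
  \<comment> \<open>Substituting \<open>\<sigma> \<circ> t\<close> for \<open>\<sigma>\<close>; twice the claim then becomes a sum over \<open>\<sigma>\<close> of instances of \<open>shifted_pair\<close>.\<close>
  have neg: "row_antisym s L \<rho> = - (\<Sum>\<sigma> | \<sigma> permutes UNIV. of_int (sign \<sigma>) * w (\<sigma> \<circ> t) \<rho>)" for \<rho>
  proof -
    have "row_antisym s L \<rho> = (\<Sum>\<sigma> | \<sigma> permutes UNIV. of_int (sign (\<sigma> \<circ> t)) * w (\<sigma> \<circ> t) \<rho>)"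
      unfolding row_antisym_def w_def[symmetric] by (rule sum_permutations_compose_right[OF t])
    also have "\<dots> = (\<Sum>\<sigma> | \<sigma> permutes UNIV. - (of_int (sign \<sigma>) * w (\<sigma> \<circ> t) \<rho>))"
      using ab by (intro sum.cong refl)
        (simp add: sign_compose permutes_imp_permutation[OF finite] t_def permutation_swap_id sign_swap_id)
    finally show ?thesis by (simp add: sum_negf)
  qed
  have 0: "w \<sigma> \<tau> - w (\<sigma> \<circ> t) \<tau> + w \<sigma> (\<tau> \<circ> t) - w (\<sigma> \<circ> t) (\<tau> \<circ> t) = 0" for \<sigma>
  proof -
    define X where "X = prod_list (map (shifted_entry s \<sigma> \<tau>) U)"
    define Y where "Y = prod_list (map (shifted_entry s \<sigma> \<tau>) V)"
    have X: "prod_list (map (shifted_entry s \<sigma>' \<tau>') U) = X" "prod_list (map (shifted_entry s \<sigma>' \<tau>') V) = Y"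
      if "\<sigma>' \<in> {\<sigma>, \<sigma> \<circ> t}" "\<tau>' \<in> {\<tau>, \<tau> \<circ> t}" for \<sigma>' \<tau>'
      unfolding X_def Y_def using that tt(3)
      by (auto intro!: arg_cong[where f = prod_list] map_cong simp: shifted_entry_def)
    have w: "w \<sigma>' \<tau>' = X * (shifted_entry s \<sigma>' \<tau>' a * shifted_entry s \<sigma>' \<tau>' b) * Y"
      if "\<sigma>' \<in> {\<sigma>, \<sigma> \<circ> t}" "\<tau>' \<in> {\<tau>, \<tau> \<circ> t}" for \<sigma>' \<tau>'
      unfolding w_def L(2) map_append list.map prod_list.append prod_list.Cons X[OF that]
      by (simp only: mult.assoc)
    have "w \<sigma> \<tau> - w (\<sigma> \<circ> t) \<tau> + w \<sigma> (\<tau> \<circ> t) - w (\<sigma> \<circ> t) (\<tau> \<circ> t)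
      = X * (shifted_entry s \<sigma> \<tau> a * shifted_entry s \<sigma> \<tau> b
        - shifted_entry s (\<sigma> \<circ> t) \<tau> a * shifted_entry s (\<sigma> \<circ> t) \<tau> b
        + shifted_entry s \<sigma> (\<tau> \<circ> t) a * shifted_entry s \<sigma> (\<tau> \<circ> t) b
        - shifted_entry s (\<sigma> \<circ> t) (\<tau> \<circ> t) a * shifted_entry s (\<sigma> \<circ> t) (\<tau> \<circ> t) b) * Y"
      by (simp add: w algebra_simps)
    also have "\<dots> = 0"
      using shifted_pair[where u = "s b" and i = "\<sigma> a" and j = "\<tau> a" and k = "\<sigma> b" and l = "\<tau> b"]
      unfolding shifted_entry_def comp_def tt s by simp
    finally show ?thesis .
  qed
  have d: "(\<Sum>\<sigma> | \<sigma> permutes UNIV. of_int (sign \<sigma>) * w \<sigma> \<rho>) = row_antisym s L \<rho>" for \<rho>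
    by (simp only: row_antisym_def w_def)
  have e: "(\<Sum>\<sigma> | \<sigma> permutes UNIV. of_int (sign \<sigma>) * w (\<sigma> \<circ> t) \<rho>) = - row_antisym s L \<rho>" for \<rho>
    by (simp only: neg minus_minus)
  have "(\<Sum>\<sigma> | \<sigma> permutes UNIV. of_int (sign \<sigma>) *
        (w \<sigma> \<tau> - w (\<sigma> \<circ> t) \<tau> + w \<sigma> (\<tau> \<circ> t) - w (\<sigma> \<circ> t) (\<tau> \<circ> t)))
      = row_antisym s L \<tau> - (- row_antisym s L \<tau>)
        + row_antisym s L (\<tau> \<circ> t) - (- row_antisym s L (\<tau> \<circ> t))"
    by (simp only: right_diff_distrib distrib_left sum.distrib sum_subtractf d e)
  then have "2 * (row_antisym s L \<tau> + row_antisym s L (\<tau> \<circ> t)) = 0"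
    by (simp only: 0 mult_zero_right sum.neutral_const mult_2) (simp add: add_ac)
  then have "row_antisym s L \<tau> + row_antisym s L (\<tau> \<circ> t) = 0"
    by (rule two_uea_cancel)
  then show ?thesis unfolding t_def by (simp add: eq_neg_iff_add_eq_0 add.commute)
qed

section \<open>The column determinant as a sum of symmetrized minors\<close>

lemma sum_permutes_map:
  assumes L: "distinct L"
  shows "(\<Sum>\<sigma> | \<sigma> permutes set L. f (map \<sigma> L)) = (\<Sum>xs\<in>permutations_of_set (set L). f xs)"
proof -
  have "bij_betw (\<lambda>\<sigma>. map \<sigma> L) {\<sigma>. \<sigma> permutes set L} (permutations_of_set (set L))"
  proof (rule bij_betw_imageI)
    show "inj_on (\<lambda>\<sigma>. map \<sigma> L) {\<sigma>. \<sigma> permutes set L}"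
    proof (rule inj_onI, rule ext)
      fix \<sigma> \<tau> p
      assume "\<sigma> \<in> {\<sigma>. \<sigma> permutes set L}" "\<tau> \<in> {\<sigma>. \<sigma> permutes set L}" "map \<sigma> L = map \<tau> L"
      then show "\<sigma> p = \<tau> p"
        by (cases "p \<in> set L") (auto simp: permutes_not_in)
    qed
    have "\<exists>\<sigma>. \<sigma> permutes set L \<and> map \<sigma> L = xs" if xs: "xs \<in> permutations_of_set (set L)" for xs
    proof -
      have set: "set xs = set L" and "distinct xs" using xs permutations_of_setD by auto
      then have len: "length xs = length L" using L by (metis distinct_card)
      define \<sigma> where "\<sigma> p = (if p \<in> set L then the (map_of (zip L xs) p) else p)" for p
      have *: "map \<sigma> L = xs"
        using L len by (intro nth_equalityI) (auto simp: \<sigma>_def map_of_zip_nth)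
      then have "\<sigma> ` set L = set L" using set by (metis list.set_map)
      then have "bij_betw \<sigma> (set L) (set L)"
        by (simp add: bij_betw_def eq_card_imp_inj_on)
      then have "\<sigma> permutes set L"
        by (rule bij_imp_permutes) (simp add: \<sigma>_def)
      then show ?thesis using * by blast
    qed
    moreover have "map \<sigma> L \<in> permutations_of_set (set L)" if "\<sigma> permutes set L" for \<sigma>
      using that L permutes_inj_on[OF that] permutes_image[OF that]
      by (auto intro!: permutations_of_setI simp: distinct_map)
    ultimately show "(\<lambda>\<sigma>. map \<sigma> L) ` {\<sigma>. \<sigma> permutes set L} = permutations_of_set (set L)"
      by blast
  qed
  then show ?thesis by (rule sum.reindex_bij_betw)
qed

lemma perm_sum_uvar:
  assumes "finite T"
  shows "perm_sum (\<lambda>q. uvar (f q)) T = uconst (fact (card T)) * Sym (\<Prod>q\<in>T. mvar (f q))"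
proof -
  obtain LT where LT: "set LT = T" "distinct LT" using assms finite_distinct_list by blast
  define m where "m = length LT"
  have m: "card T = m" using LT by (auto simp: m_def distinct_card)
  have T: "T = (!) LT ` {..<m}" using LT(1) by (auto simp: m_def set_conv_nth)
  have inj: "inj_on ((!) LT) {..<m}" using LT(2) by (simp add: m_def inj_on_nth)
  have "Sym (\<Prod>q\<in>T. mvar (f q)) = Sym (prod_list (map mvar (map f LT)))"
    unfolding LT(1)[symmetric] prod.distinct_set_conv_list[OF LT(2)] by (simp add: comp_def)
  also have "\<dots> = uconst (1 / fact m) *
     (\<Sum>\<sigma> | \<sigma> permutes set [0..<m]. prod_list (map (\<lambda>q. uvar (f q)) (map ((!) LT) (map \<sigma> [0..<m]))))"
  proof -
    have *: "map (\<lambda>i. uvar (map f LT ! \<sigma> i)) [0..<m] = map (\<lambda>q. uvar (f q)) (map ((!) LT) (map \<sigma> [0..<m]))"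
      if "\<sigma> permutes {..<m}" for \<sigma>
      using permutes_in_image[OF that] by (simp add: m_def)
    have "(\<Sum>\<sigma> | \<sigma> permutes {..<m}. prod_list (map (\<lambda>i. uvar (map f LT ! \<sigma> i)) [0..<m]))
      = (\<Sum>\<sigma> | \<sigma> permutes {..<m}. prod_list (map (\<lambda>q. uvar (f q)) (map ((!) LT) (map \<sigma> [0..<m]))))"
      by (intro sum.cong refl) (simp only: mem_Collect_eq *)
    then show ?thesis
      unfolding Sym_monomial sym_product_def length_map m_def[symmetric] set_upt atLeast0LessThan
      by simp
  qed
  also have "\<dots> = uconst (1 / fact m) * perm_sum (\<lambda>q. uvar (f q)) T"
    unfolding sum_permutes_map[OF distinct_upt, where f = "\<lambda>xs. prod_list (map (\<lambda>q. uvar (f q)) (map ((!) LT) xs))"]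
    unfolding perm_sum_def T permutations_of_set_image_inj[OF inj]
    by (subst sum.reindex) (auto simp: atLeast0LessThan inj intro!: inj_onI map_inj_on[of "(!) LT"]
       inj_on_subset[OF inj] dest: permutations_of_setD)
  finally show ?thesis
    by (simp add: m flip: mult.assoc uconst_mult)
qed

text \<open>
  The shift on the diagonal: \<open>n - 1 - i - (n - 1)/2\<close> at the column with \<open>i\<close> predecessors.
\<close>

definition capelli_shift :: "'n::{finite,linorder} \<Rightarrow> complex" where
  "capelli_shift p = of_nat (card {p<..}) - (of_nat CARD('n) - 1) / 2"

lemma card_greaterThan_nth:
  fixes i :: nat
  defines "L \<equiv> sorted_list_of_set (UNIV :: 'n::{finite,linorder} set)"
  assumes "i < CARD('n)"
  shows "card {L ! i<..} = CARD('n) - Suc i"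
proof -
  have len: "length L = CARD('n)" and set: "set L = UNIV" and d: "distinct L"
    and lt: "\<And>i j. i < j \<Longrightarrow> j < length L \<Longrightarrow> L ! i < L ! j"
    using strict_sorted_list_of_set[of "UNIV :: 'n set"]
    by (auto simp: L_def sorted_wrt_iff_nth_less)
  have "{L ! i<..} = (!) L ` {Suc i..<CARD('n)}"
  proof (intro set_eqI iffI)
    fix x assume x: "x \<in> {L ! i<..}"
    obtain j where j: "j < CARD('n)" "x = L ! j" using set len by (metis UNIV_I in_set_conv_nth)
    then have "i < j" using x lt[of j i] assms(2) len by (metis greaterThan_iff less_asym nat_neq_iff)
    then show "x \<in> (!) L ` {Suc i..<CARD('n)}" using j by auto
  qed (use lt len in auto)
  moreover have "inj_on ((!) L) {Suc i..<CARD('n)}"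
    using d len by (auto intro: inj_on_nth)
  ultimately show ?thesis by (simp add: card_image)
qed

lemma capelli_shift_nth:
  assumes "i < CARD('n)"
  shows "capelli_shift (sorted_list_of_set (UNIV :: 'n::{finite,linorder} set) ! i)
    = (of_nat CARD('n) - 1) / 2 - of_nat i"
  using assms by (simp add: capelli_shift_def card_greaterThan_nth of_nat_diff field_simps)

lemma row_antisym_permutes:
  fixes \<tau> :: "'n::{finite,linorder} \<Rightarrow> 'n"
  defines "L \<equiv> sorted_list_of_set (UNIV :: 'n set)"
  assumes "\<tau> permutes UNIV"
  shows "row_antisym capelli_shift L \<tau> = of_int (sign \<tau>) * row_antisym capelli_shift L id"
proof (rule alternating_of_adjacent[of L, OF _ _ _ assms(2)])
  show d: "distinct L" and "set L = UNIV" by (simp_all add: L_def)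
  fix \<rho> i assume i: "Suc i < length L"
  have len: "length L = CARD('n)" by (simp add: L_def)
  have "L = take i L @ L ! i # L ! Suc i # drop (Suc (Suc i)) L"
    using i by (simp add: Cons_nth_drop_Suc id_take_nth_drop[symmetric])
  moreover have "capelli_shift (L ! i) = capelli_shift (L ! Suc i) + 1"
    using i len unfolding L_def by (simp add: capelli_shift_nth)
  ultimately show "row_antisym capelli_shift L (\<rho> \<circ> Transposition.transpose (L ! i) (L ! Suc i))
      = - row_antisym capelli_shift L \<rho>"
    by (rule row_antisym_swap[OF d])
qed

text \<open>
  The indicator, as a complex number, of \<open>\<pi>\<close> fixing every point outside \<open>T\<close>.
\<close>

definition fixes_off :: "('n \<Rightarrow> 'n) \<Rightarrow> 'n set \<Rightarrow> complex" where
  "fixes_off \<pi> T = (\<Prod>q\<in>UNIV - T. of_bool (\<pi> q = q))"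

lemma sign_mult_cancel: "of_int (sign \<tau>) * (of_int (sign \<tau>) * y) = (y :: 'u::ring_1)"
  by (simp add: sign_def)

text \<open>
  Reindexing the pairs \<open>(\<sigma>, \<tau>)\<close> by \<open>(\<sigma>, \<pi>)\<close> with \<open>\<tau> = \<pi> \<circ> \<sigma>\<close> makes \<open>\<sigma>\<close> run over the orderings of the rows, while
  the sign depends on \<open>\<pi>\<close> alone.
\<close>

lemma row_antisym_expand:
  fixes L :: "'n::finite list"
  assumes L: "distinct L" "set L = UNIV"
  shows "(\<Sum>\<tau> | \<tau> permutes UNIV. of_int (sign \<tau>) * row_antisym s L \<tau>)
    = (\<Sum>\<pi> | \<pi> permutes UNIV. of_int (sign \<pi>) * (\<Sum>T\<in>UNIV.
        uconst (fixes_off \<pi> T * fact (CARD('n) - card T) * fact (card T) *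
          poly.coeff (\<Prod>s\<leftarrow>map s L. [:s, 1:]) (card T)) * Sym (\<Prod>q\<in>T. mvar (E q (\<pi> q)))))"
proof -
  have inner: "(\<Sum>\<tau> | \<tau> permutes UNIV. of_int (sign \<tau>) * (of_int (sign \<sigma>) * prod_list (map (shifted_entry s \<sigma> \<tau>) L)))
      = (\<Sum>\<pi> | \<pi> permutes UNIV. of_int (sign \<pi>) * prod_list (map (shifted_entry s \<sigma> (\<pi> \<circ> \<sigma>)) L))"
    if \<sigma>: "\<sigma> permutes UNIV" for \<sigma>
  proof -
    have "of_int (sign (\<pi> \<circ> \<sigma>)) * (of_int (sign \<sigma>) * y) = of_int (sign \<pi>) * y"
      if "\<pi> permutes UNIV" for \<pi> and y :: "'n gl_basis uea"
    proof -
      have "sign (\<pi> \<circ> \<sigma>) = sign \<pi> * sign \<sigma>"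
        using that \<sigma> by (simp add: sign_compose permutes_imp_permutation[OF finite])
      then show ?thesis
        by (simp only: of_int_mult mult.assoc sign_mult_cancel)
    qed
    then show ?thesis
      by (subst sum_permutations_compose_right[OF \<sigma>]) (auto intro!: sum.cong)
  qed
  have "(\<Sum>\<tau> | \<tau> permutes UNIV. of_int (sign \<tau>) * row_antisym s L \<tau>)
    = (\<Sum>\<sigma> | \<sigma> permutes UNIV. \<Sum>\<tau> | \<tau> permutes UNIV.
        of_int (sign \<tau>) * (of_int (sign \<sigma>) * prod_list (map (shifted_entry s \<sigma> \<tau>) L)))"
    unfolding row_antisym_def sum_distrib_left by (rule sum.swap)
  also have "\<dots> = (\<Sum>\<sigma> | \<sigma> permutes UNIV. \<Sum>\<pi> | \<pi> permutes UNIV.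
        of_int (sign \<pi>) * prod_list (map (shifted_entry s \<sigma> (\<pi> \<circ> \<sigma>)) L))"
    by (rule sum.cong) (simp_all add: inner)
  also have "\<dots> = (\<Sum>\<pi> | \<pi> permutes UNIV. of_int (sign \<pi>) *
       (\<Sum>\<sigma> | \<sigma> permutes UNIV. prod_list (map (shifted_entry s \<sigma> (\<pi> \<circ> \<sigma>)) L)))"
    unfolding sum_distrib_left by (rule sum.swap)
  also have "\<dots> = (\<Sum>\<pi> | \<pi> permutes UNIV. of_int (sign \<pi>) * (\<Sum>T\<in>UNIV.
        uconst (fixes_off \<pi> T * fact (CARD('n) - card T) * fact (card T) *
          poly.coeff (\<Prod>s\<leftarrow>map s L. [:s, 1:]) (card T)) * Sym (\<Prod>q\<in>T. mvar (E q (\<pi> q)))))"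
  proof (rule sum.cong[OF refl], rule arg_cong2[where f="(*)", OF refl])
    fix \<pi> :: "'n \<Rightarrow> 'n"
    have eq: "map (shifted_entry s \<sigma> (\<pi> \<circ> \<sigma>)) L
       = map2 (\<lambda>q t. uvar (E q (\<pi> q)) + uconst (t * of_bool (\<pi> q = q))) (map \<sigma> L) (map s L)" for \<sigma>
      by (rule nth_equalityI) (auto simp: shifted_entry_def intro!: arg_cong[where f = uconst])
    have "(\<Sum>\<sigma> | \<sigma> permutes UNIV. prod_list (map (shifted_entry s \<sigma> (\<pi> \<circ> \<sigma>)) L))
      = (\<Sum>xs\<in>permutations_of_set UNIV. prod_list (map2 (\<lambda>q t. uvar (E q (\<pi> q)) + uconst (t * of_bool (\<pi> q = q))) xs (map s L)))"
      unfolding eq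
      by (rule sum_permutes_map[OF L(1), unfolded L(2), where f = "\<lambda>xs. prod_list (map2
            (\<lambda>q t. uvar (E q (\<pi> q)) + uconst (t * of_bool (\<pi> q = q))) xs (map s L))"])
    also have "\<dots> = (\<Sum>T\<in>Pow UNIV. uconst ((\<Prod>x\<in>UNIV - T. of_bool (\<pi> x = x)) * fact (card (UNIV - T)) *
        poly.coeff (\<Prod>s\<leftarrow>map s L. [:s, 1:]) (card T)) * perm_sum (\<lambda>q. uvar (E q (\<pi> q))) T)"
      by (rule shifted_perm_sum) (use L in \<open>simp_all add: distinct_card[symmetric]\<close>)
    also have "\<dots> = (\<Sum>T\<in>UNIV.
        uconst (fixes_off \<pi> T * fact (CARD('n) - card T) * fact (card T) *
          poly.coeff (\<Prod>s\<leftarrow>map s L. [:s, 1:]) (card T)) * Sym (\<Prod>q\<in>T. mvar (E q (\<pi> q))))"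
      unfolding perm_sum_uvar[OF finite] mult.assoc[symmetric] uconst_mult[symmetric] fixes_off_def
      by (simp add: card_Diff_subset mult_ac)
    finally show "(\<Sum>\<sigma> | \<sigma> permutes UNIV. prod_list (map (shifted_entry s \<sigma> (\<pi> \<circ> \<sigma>)) L)) = \<dots>" .
  qed
  finally show ?thesis .
qed

theorem col_det_capelli:
  "col_det ((\<chi> i j. uvar (E i j)) + diag_matrix (\<lambda>i. uconst (of_nat (card {i<..})))
      - mat (uconst ((of_nat CARD('n) - 1) / 2))
      :: 'n::{finite,linorder} gl_basis uea ^ 'n::{finite,linorder} ^ 'n::{finite,linorder})
   = (\<Sum>\<pi> | \<pi> permutes UNIV. of_int (sign \<pi>) * (\<Sum>T\<in>UNIV.
        uconst (fixes_off \<pi> T * fact (CARD('n) - card T) *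
          (inverse sinhc_half ^ Suc CARD('n)) $ (CARD('n) - card T)) * Sym (\<Prod>q\<in>T. mvar (E q (\<pi> q)))))"
  (is "col_det ?M = ?R")
proof -
  define L where "L = sorted_list_of_set (UNIV :: 'n set)"
  have L: "distinct L" "set L = UNIV" "length L = CARD('n)" by (simp_all add: L_def)
  have "?M $h \<sigma> j $h j = shifted_entry capelli_shift \<sigma> id j" for \<sigma> j
    by (auto simp: shifted_entry_def capelli_shift_def diag_matrix_def mat_def uconst_diff)
  then have c: "col_det ?M = row_antisym capelli_shift L id"
    unfolding col_det_def row_antisym_def L_def by simp
  have "map capelli_shift L = map (\<lambda>i. (of_nat CARD('n) - 1) / 2 - of_nat i) [0..<CARD('n)]"
    by (rule nth_equalityI) (simp_all add: L(3), simp add: L_def capelli_shift_nth)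
  then have p: "(\<Prod>s\<leftarrow>map capelli_shift L. [:s, 1:])
      = (\<Prod>i<CARD('n). [:(of_nat CARD('n) - 1) / 2 - of_nat i :: complex, 1:])"
    by (simp add: comp_def prod.list_conv_set_nth[of "map _ _"] atLeast0LessThan)
  have "uconst (fact CARD('n)) * col_det ?M
      = (\<Sum>\<tau> | \<tau> permutes (UNIV :: 'n set). row_antisym capelli_shift L id)"
  proof -
    have "uconst (fact CARD('n)) = (of_nat (fact CARD('n)) :: 'n gl_basis uea)"
      unfolding uconst_of_nat[symmetric] by (simp only: of_nat_fact)
    then show ?thesis
      unfolding c by (simp only: sum_constant card_permutations[OF refl finite])
  qed
  also have "\<dots> = (\<Sum>\<tau> | \<tau> permutes UNIV. of_int (sign \<tau>) * row_antisym capelli_shift L \<tau>)"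
  proof (rule sum.cong[OF refl])
    fix \<tau> :: "'n \<Rightarrow> 'n" assume "\<tau> \<in> {\<tau>. \<tau> permutes UNIV}"
    then show "row_antisym capelli_shift L id = of_int (sign \<tau>) * row_antisym capelli_shift L \<tau>"
      unfolding L_def by (simp only: mem_Collect_eq row_antisym_permutes[of \<tau>] sign_mult_cancel)
  qed
  also have "\<dots> = (\<Sum>\<pi> | \<pi> permutes UNIV. of_int (sign \<pi>) * (\<Sum>T\<in>UNIV. uconst (fact CARD('n)) * (
        uconst (fixes_off \<pi> T * fact (CARD('n) - card T) *
          (inverse sinhc_half ^ Suc CARD('n)) $ (CARD('n) - card T)) * Sym (\<Prod>q\<in>T. mvar (E q (\<pi> q))))))"
  proof -
    have "fixes_off \<pi> T * fact (CARD('n) - card T) * fact (card T) *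
          poly.coeff (\<Prod>s\<leftarrow>map capelli_shift L. [:s, 1:]) (card T)
        = fact CARD('n) * (fixes_off \<pi> T * fact (CARD('n) - card T) *
          (inverse sinhc_half ^ Suc CARD('n)) $ (CARD('n) - card T))" for \<pi> and T :: "'n set"
      using norlund_coeff[of "card T" "CARD('n)"] unfolding p
      by (simp add: card_mono mult_ac del: power_Suc)
    then show ?thesis
      unfolding row_antisym_expand[OF L(1,2)] by (simp only: uconst_mult mult.assoc)
  qed
  also have "\<dots> = uconst (fact CARD('n)) * ?R"
    by (simp only: sum_distrib_left[symmetric] mult_uconst_left_commute[of "of_int z" for z])
  finally show ?thesis
    by (rule uconst_cancel[rotated]) simp
qed

section \<open>Constant-coefficient operators on the determinant\<close>

lemma diff_op_superset:
  assumes "finite A" "Poly_Mapping.keys q \<subseteq> A" "finite B" "Poly_Mapping.keys p \<subseteq> B"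
  shows "diff_op q p = (\<Sum>\<alpha>\<in>A. \<Sum>m\<in>B.
     Poly_Mapping.single (m - \<alpha>) (Poly_Mapping.lookup q \<alpha> * Poly_Mapping.lookup p m *
       of_nat (\<Prod>a\<in>UNIV. fact (Poly_Mapping.lookup \<alpha> a) * (Poly_Mapping.lookup m a choose Poly_Mapping.lookup \<alpha> a))))"
proof -
  have "diff_op q p = (\<Sum>\<alpha>\<in>Poly_Mapping.keys q. \<Sum>m\<in>B.
     Poly_Mapping.single (m - \<alpha>) (Poly_Mapping.lookup q \<alpha> * Poly_Mapping.lookup p m *
       of_nat (\<Prod>a\<in>UNIV. fact (Poly_Mapping.lookup \<alpha> a) * (Poly_Mapping.lookup m a choose Poly_Mapping.lookup \<alpha> a))))"
    unfolding diff_op_def using assms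
    by (intro sum.cong refl sum.mono_neutral_left) (auto simp: in_keys_iff)
  also have "\<dots> = (\<Sum>\<alpha>\<in>A. \<Sum>m\<in>B.
     Poly_Mapping.single (m - \<alpha>) (Poly_Mapping.lookup q \<alpha> * Poly_Mapping.lookup p m *
       of_nat (\<Prod>a\<in>UNIV. fact (Poly_Mapping.lookup \<alpha> a) * (Poly_Mapping.lookup m a choose Poly_Mapping.lookup \<alpha> a))))"
    using assms by (intro sum.mono_neutral_left) (auto simp: in_keys_iff)
  finally show ?thesis .
qed

lemma diff_op_add_left: "diff_op (p + q) r = diff_op p r + diff_op q r"
proof -
  let ?A = "Poly_Mapping.keys p \<union> Poly_Mapping.keys q" and ?B = "Poly_Mapping.keys r"
  have "Poly_Mapping.keys (p + q) \<subseteq> ?A" by (rule keys_add)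
  then show ?thesis
    by (subst (1 2 3) diff_op_superset[of ?A _ ?B])
       (simp_all add: lookup_add distrib_right sum.distrib single_add)
qed

lemma diff_op_add_right: "diff_op p (q + r) = diff_op p q + diff_op p r"
proof -
  let ?A = "Poly_Mapping.keys p" and ?B = "Poly_Mapping.keys q \<union> Poly_Mapping.keys r"
  have "Poly_Mapping.keys (q + r) \<subseteq> ?B" by (rule keys_add)
  then show ?thesis
    by (subst (1 2 3) diff_op_superset[of ?A _ ?B])
       (simp_all add: lookup_add distrib_right distrib_left sum.distrib single_add)
qed

lemma diff_op_0 [simp]: "diff_op 0 p = 0" "diff_op p 0 = 0"
  by (simp_all add: diff_op_def)

lemma diff_op_sum_left: "diff_op (sum f A) p = (\<Sum>a\<in>A. diff_op (f a) p)"
  by (induction A rule: infinite_finite_induct) (simp_all add: diff_op_add_left)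

lemma diff_op_sum_right: "diff_op p (sum f A) = (\<Sum>a\<in>A. diff_op p (f a))"
  by (induction A rule: infinite_finite_induct) (simp_all add: diff_op_add_right)

lemma diff_op_single:
  "diff_op (Poly_Mapping.single \<alpha> c) (Poly_Mapping.single m d) =
     Poly_Mapping.single (m - \<alpha>) (c * d *
       of_nat (\<Prod>a\<in>UNIV. fact (Poly_Mapping.lookup \<alpha> a) * (Poly_Mapping.lookup m a choose Poly_Mapping.lookup \<alpha> a)))"
  by (subst diff_op_superset[of "{\<alpha>}" _ "{m}"]) auto

lemma falling_factorial_add:
  "fact (i + j) * (n choose (i + j)) = (fact j * (n choose j)) * (fact i * ((n - j) choose i))"
proof (cases "i + j \<le> n")
  case True
  have "of_nat (fact (i + j) * (n choose (i + j)))
      = (of_nat ((fact j * (n choose j)) * (fact i * ((n - j) choose i))) :: real)"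
    using True by (simp add: binomial_fact field_simps)
  then show ?thesis by (simp only: of_nat_eq_iff)
next
  case False
  then have "n choose (i + j) = 0" and "n choose j = 0 \<or> (n - j) choose i = 0"
    by (auto simp: not_le binomial_eq_0)
  then show ?thesis by (elim disjE) (simp_all add: binomial_eq_0)
qed

lemma diff_op_mult: "diff_op (p * q) r = diff_op p (diff_op q r)"
proof (induction p rule: poly_mapping_induct_add)
  case p: (single \<alpha> c)
  show ?case
  proof (induction q rule: poly_mapping_induct_add)
    case q: (single \<beta> d)
    show ?case
    proof (induction r rule: poly_mapping_induct_add)
      case (single m e)
      show ?case
        unfolding mult_single diff_op_single
        by (rule arg_cong2[where f = Poly_Mapping.single])
           (simp_all add: add.commute[of \<alpha>] diff_diff_add lookup_add lookup_minus
             falling_factorial_add[of "Poly_Mapping.lookup \<alpha> _"] add.commute[of "Poly_Mapping.lookup \<beta> _"] prod.distrib)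
    qed (simp add: diff_op_add_right)
  qed (simp add: diff_op_add_left diff_op_add_right distrib_left)
qed (simp add: diff_op_add_left distrib_right)

lemma diff_op_mconst: "diff_op (mconst c) p = mconst c * p"
proof (induction p rule: poly_mapping_induct_add)
  case (single m d)
  show ?case unfolding mconst_def diff_op_single by (simp add: mult_single)
qed (simp add: diff_op_add_right distrib_left)

lemma diff_op_mconst_mult_right: "diff_op q (mconst c * p) = mconst c * diff_op q p"
  by (metis diff_op_mconst diff_op_mult mult.commute)

lemma diff_op_of_int_mult_right: "diff_op q (of_int z * p) = of_int z * diff_op q p"
  using diff_op_mconst_mult_right[of q "of_int z" p] by (simp add: mconst_of_int)

lemma diff_op_mvar_single:
  "diff_op (mvar a) (Poly_Mapping.single m d) =
     Poly_Mapping.single (m - Poly_Mapping.single a 1) (d * of_nat (Poly_Mapping.lookup m a))"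
proof -
  have "(\<Prod>b\<in>UNIV. fact (Poly_Mapping.lookup (Poly_Mapping.single a (1::nat)) b) *
          (Poly_Mapping.lookup m b choose Poly_Mapping.lookup (Poly_Mapping.single a 1) b))
      = (\<Prod>b\<in>UNIV. if b = a then Poly_Mapping.lookup m a else 1)"
    by (rule prod.cong) (auto simp: lookup_single when_def)
  then show ?thesis
    unfolding mvar_def diff_op_single by (simp add: prod.delta)
qed

lemma diff_op_mvar_mult:
  "diff_op (mvar a) (mvar b * p) = (if a = b then p else 0) + mvar b * diff_op (mvar a) p"
proof (induction p rule: poly_mapping_induct_add)
  case (single m d)
  have m: "Poly_Mapping.single b 1 + (m - Poly_Mapping.single b 1) = m" if "Poly_Mapping.lookup m b \<noteq> 0"
    using that by (intro poly_mapping_eqI) (auto simp: lookup_add lookup_minus lookup_single when_def)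
  have m': "Poly_Mapping.single b 1 + m - Poly_Mapping.single a 1
      = Poly_Mapping.single b 1 + (m - Poly_Mapping.single a 1)" if "a \<noteq> b"
    using that by (intro poly_mapping_eqI) (auto simp: lookup_add lookup_minus lookup_single when_def)
  have "mvar b * Poly_Mapping.single k e = Poly_Mapping.single (Poly_Mapping.single b 1 + k) e" for k and e :: complex
    by (simp add: mvar_def mult_single)
  then show ?case
    using m m' by (cases "Poly_Mapping.lookup m b = 0")
       (auto simp: diff_op_mvar_single lookup_add lookup_single distrib_left single_add when_def)
qed (simp add: diff_op_add_right distrib_left)

lemma diff_op_mvar_prod:
  assumes "finite T"
  shows "diff_op (mvar a) (\<Prod>q\<in>T. mvar (f q))
    = (\<Sum>q\<in>T. if f q = a then \<Prod>r\<in>T - {q}. mvar (f r) else 0)"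
  using assms
proof induction
  case empty
  show ?case unfolding mconst_1[symmetric] mconst_def diff_op_mvar_single prod.empty by simp
next
  case (insert x T)
  have "insert x T - {q} = insert x (T - {q})" if "q \<in> T" for q using that insert by auto
  then have "(\<Sum>q\<in>T. if f q = a then \<Prod>r\<in>insert x T - {q}. mvar (f r) else 0)
     = (\<Sum>q\<in>T. mvar (f x) * (if f q = a then \<Prod>r\<in>T - {q}. mvar (f r) else 0))"
    using insert by (intro sum.cong) auto
  then show ?case using insert
    by (simp add: diff_op_mvar_mult sum_distrib_left)
qed

text \<open>
  The part of the Leibniz monomial of \<open>\<pi>\<close> that comes from the rows in \<open>T\<close>.
\<close>

definition row_monomial :: "('n \<Rightarrow> 'n) \<Rightarrow> 'n set \<Rightarrow> 'n::finite gl_basis mpoly" where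
  "row_monomial \<pi> T = (\<Prod>q\<in>T. mvar (E q (\<pi> q)))"

lemma diff_op_row_monomial:
  "diff_op (mvar (E i j)) (row_monomial \<pi> T)
    = (if i \<in> T \<and> \<pi> i = j then row_monomial \<pi> (T - {i}) else 0)"
proof -
  have "diff_op (mvar (E i j)) (row_monomial \<pi> T)
     = (\<Sum>q\<in>T. if q = i then (if \<pi> i = j then row_monomial \<pi> (T - {i}) else 0) else 0)"
    unfolding row_monomial_def by (subst diff_op_mvar_prod, simp, rule sum.cong) auto
  then show ?thesis by (simp add: sum.delta)
qed

definition det_poly :: "'n::finite gl_basis mpoly" where
  "det_poly = det (\<chi> i j. mvar (E i j))"

lemma det_poly_eq: "det_poly = (\<Sum>\<pi> | \<pi> permutes UNIV. of_int (sign \<pi>) * row_monomial \<pi> UNIV)"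
  by (simp add: det_poly_def det_def row_monomial_def)

text \<open>
  A \<open>2 \<times> 2\<close> permanent of partial derivatives kills the determinant: composing \<open>\<pi>\<close> with the transposition of
  \<open>i\<close> and \<open>k\<close> exchanges the two second derivatives and changes the sign.
\<close>

lemma diff_op_minor_relation:
  "diff_op (mvar (E i j) * mvar (E k l) + mvar (E i l) * mvar (E k j)) det_poly = 0"
proof -
  define R where "R \<pi> j l = (if i \<noteq> k \<and> \<pi> k = l \<and> \<pi> i = j then row_monomial \<pi> (UNIV - {k} - {i}) else 0)" for \<pi> j l
  have D: "diff_op (mvar (E i j) * mvar (E k l)) det_poly = (\<Sum>\<pi> | \<pi> permutes UNIV. of_int (sign \<pi>) * R \<pi> j l)" for j l
    unfolding diff_op_mult det_poly_eq diff_op_sum_right diff_op_of_int_mult_right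
    by (auto intro!: sum.cong simp: diff_op_row_monomial R_def)
  show ?thesis
  proof (cases "i = k")
    case True
    then show ?thesis unfolding diff_op_add_left D by (simp add: R_def)
  next
    case False
    define t where "t = Transposition.transpose i k"
    have t: "t permutes UNIV" by (simp add: t_def permutes_swap_id)
    have "(\<Sum>\<pi> | \<pi> permutes UNIV. of_int (sign \<pi>) * R \<pi> l j)
       = (\<Sum>\<pi> | \<pi> permutes UNIV. of_int (sign (\<pi> \<circ> t)) * R (\<pi> \<circ> t) l j)"
      by (rule sum_permutations_compose_right[OF t])
    also have "\<dots> = (\<Sum>\<pi> | \<pi> permutes UNIV. - (of_int (sign \<pi>) * R \<pi> j l))"
    proof (rule sum.cong[OF refl])
      fix \<pi> :: "'a \<Rightarrow> 'a" assume "\<pi> \<in> {\<pi>. \<pi> permutes UNIV}"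
      then have "sign (\<pi> \<circ> t) = - sign \<pi>"
        using False by (simp add: sign_compose permutes_imp_permutation[OF finite] t_def permutation_swap_id sign_swap_id)
      moreover have "row_monomial (\<pi> \<circ> t) (UNIV - {k} - {i}) = row_monomial \<pi> (UNIV - {k} - {i})"
        unfolding row_monomial_def by (intro prod.cong refl) (auto simp: t_def Transposition.transpose_def)
      then have "R (\<pi> \<circ> t) l j = R \<pi> j l"
        by (auto simp: R_def t_def)
      ultimately show "of_int (sign (\<pi> \<circ> t)) * R (\<pi> \<circ> t) l j = - (of_int (sign \<pi>) * R \<pi> j l)"
        by simp
    qed
    finally show ?thesis by (simp add: diff_op_add_left D sum_negf)
  qed
qed

text \<open>
  The trace, as a linear form in the coordinates on \<open>gl\<^sub>n\<close>.
\<close>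

definition trace_var :: "'n::finite gl_basis mpoly" where
  "trace_var = (\<Sum>i\<in>UNIV. mvar (E i i))"

text \<open>
  The sum of the principal minors of size \<open>n - k\<close> of the matrix of variables. A permutation that fixes every
  point off \<open>T\<close> is a permutation of \<open>T\<close>, so \<open>T\<close> is the set of rows of the minor.
\<close>

definition principal_minors :: "nat \<Rightarrow> 'n::finite gl_basis mpoly" where
  "principal_minors k = (\<Sum>\<pi> | \<pi> permutes UNIV. of_int (sign \<pi>) *
     (\<Sum>T\<in>UNIV. mconst (fixes_off \<pi> T * of_bool (card (UNIV - T) = k)) * row_monomial \<pi> T))"

text \<open>
  Differentiating along the identity matrix removes a diagonal variable from a minor; each set with
  \<open>Suc k\<close> missing rows arises in \<open>Suc k\<close> ways.
\<close>

lemma diff_op_trace_var_minors: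
  "diff_op trace_var (principal_minors k) = mconst (of_nat (Suc k)) * (principal_minors (Suc k) :: 'n::finite gl_basis mpoly)"
proof -
  define c where "c \<pi> k T = (mconst (fixes_off \<pi> T * of_bool (card (UNIV - T) = k)) :: 'n gl_basis mpoly)" for \<pi> :: "'n \<Rightarrow> 'n" and k T
  have "diff_op trace_var (\<Sum>T\<in>UNIV. c \<pi> k T * row_monomial \<pi> T)
      = mconst (of_nat (Suc k)) * (\<Sum>T\<in>UNIV. c \<pi> (Suc k) T * row_monomial \<pi> T)" for \<pi>
  proof -
    have "diff_op trace_var (\<Sum>T\<in>UNIV. c \<pi> k T * row_monomial \<pi> T)
      = (\<Sum>T\<in>UNIV. c \<pi> k T * (\<Sum>i\<in>UNIV. if i \<in> T \<and> \<pi> i = i then row_monomial \<pi> (T - {i}) else 0))"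
      unfolding trace_var_def diff_op_sum_left diff_op_sum_right c_def diff_op_mconst_mult_right diff_op_row_monomial
      sum_distrib_left ..
    also have "\<dots> = (\<Sum>T\<in>Pow UNIV. \<Sum>i\<in>T. c \<pi> (Suc k) (T - {i}) * row_monomial \<pi> (T - {i}))"
    proof (rule sum.cong)
      fix T :: "'n set"
      have "c \<pi> k T * (if \<pi> i = i then row_monomial \<pi> (T - {i}) else 0)
          = c \<pi> (Suc k) (T - {i}) * row_monomial \<pi> (T - {i})" if "i \<in> T" for i
      proof -
        have U: "UNIV - (T - {i}) = insert i (UNIV - T)" using that by auto
        have "fixes_off \<pi> (T - {i}) = of_bool (\<pi> i = i) * fixes_off \<pi> T"
          unfolding fixes_off_def U using that by (subst prod.insert) auto
        moreover have "card (UNIV - (T - {i})) = Suc (card (UNIV - T))"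
          unfolding U using that by (subst card_insert_disjoint) auto
        ultimately show ?thesis by (simp add: c_def)
      qed
      then have "(\<Sum>i\<in>T. c \<pi> k T * (if \<pi> i = i then row_monomial \<pi> (T - {i}) else 0))
         = (\<Sum>i\<in>T. c \<pi> (Suc k) (T - {i}) * row_monomial \<pi> (T - {i}))"
        by (intro sum.cong) auto
      moreover have "(\<Sum>i\<in>UNIV. if i \<in> T \<and> \<pi> i = i then row_monomial \<pi> (T - {i}) else 0)
          = (\<Sum>i\<in>T. if \<pi> i = i then row_monomial \<pi> (T - {i}) else 0)"
        by (rule sum.mono_neutral_cong_right) auto
      ultimately show "c \<pi> k T * (\<Sum>i\<in>UNIV. if i \<in> T \<and> \<pi> i = i then row_monomial \<pi> (T - {i}) else 0)
         = (\<Sum>i\<in>T. c \<pi> (Suc k) (T - {i}) * row_monomial \<pi> (T - {i}))"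
        by (simp add: sum_distrib_left)
    qed simp
    also have "\<dots> = (\<Sum>T\<in>Pow UNIV. \<Sum>i\<in>UNIV - T. c \<pi> (Suc k) T * row_monomial \<pi> T)"
      using sum_subsets_insert[of UNIV "\<lambda>i T. c \<pi> (Suc k) T * row_monomial \<pi> T"]
        sum_subsets_remove[of UNIV "\<lambda>i T. c \<pi> (Suc k) T * row_monomial \<pi> T"] by (simp only: finite)
    also have "\<dots> = (\<Sum>T\<in>UNIV. mconst (of_nat (Suc k)) * (c \<pi> (Suc k) T * row_monomial \<pi> T))"
      by (rule sum.cong) (auto simp: c_def mconst_of_nat simp del: of_nat_Suc)
    finally show ?thesis by (simp only: sum_distrib_left)
  qed
  then show ?thesis
    unfolding principal_minors_def c_def[symmetric] diff_op_sum_right diff_op_of_int_mult_right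
    by (simp only: sum_distrib_left mult.left_commute)
qed

lemma principal_minors_0: "principal_minors 0 = det_poly"
proof -
  have "(\<Sum>T\<in>UNIV. mconst (fixes_off \<pi> T * of_bool (card (UNIV - T) = 0)) * row_monomial \<pi> T)
     = (\<Sum>T\<in>{UNIV}. mconst (fixes_off \<pi> T * of_bool (card (UNIV - T) = 0)) * row_monomial \<pi> T)" for \<pi> :: "'a \<Rightarrow> 'a"
    by (rule sum.mono_neutral_right) auto
  then show ?thesis by (simp add: principal_minors_def det_poly_eq fixes_off_def)
qed

theorem diff_op_trace_var_power: "diff_op (trace_var ^ k) det_poly
    = mconst (fact k) * (principal_minors k :: 'n::finite gl_basis mpoly)"
proof (induction k)
  case 0
  show ?case using diff_op_mconst[of 1 det_poly] by (simp add: principal_minors_0)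
next
  case (Suc k)
  have "diff_op (trace_var ^ Suc k) det_poly
      = mconst (fact k) * (mconst (of_nat (Suc k)) * (principal_minors (Suc k) :: 'n gl_basis mpoly))"
    by (simp only: power_Suc diff_op_mult Suc diff_op_mconst_mult_right diff_op_trace_var_minors)
  then show ?case by (simp only: fact_Suc of_nat_mult mconst_mult mult_ac of_nat_id)
qed

lemma principal_minors_eq_0: "k > CARD('n) \<Longrightarrow> (principal_minors k :: 'n::finite gl_basis mpoly) = 0"
proof -
  assume k: "k > CARD('n)"
  have "card (UNIV - T) \<noteq> k" for T :: "'n set"
    using card_mono[of UNIV "UNIV - T"] k by auto
  then show ?thesis by (simp add: principal_minors_def)
qed

section \<open>The apolar algebra of the determinant\<close>

text \<open>
  The polynomials \<open>q\<close> for which \<open>q(\<partial>)\<close> annihilates the determinant. The quantifier over \<open>r\<close> makes this an ideal by definition; it loses nothing,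
  since \<open>(q r)(\<partial>) = r(\<partial>) q(\<partial>)\<close>.
\<close>

definition det_annihilator :: "'n::finite gl_basis mpoly set" where
  "det_annihilator = {q. \<forall>r. diff_op (q * r) det_poly = 0}"

lemma det_annihilator_0: "0 \<in> det_annihilator"
  by (simp add: det_annihilator_def)

lemma det_annihilator_add: "p \<in> det_annihilator \<Longrightarrow> q \<in> det_annihilator \<Longrightarrow> p + q \<in> det_annihilator"
  by (simp add: det_annihilator_def distrib_right diff_op_add_left)

lemma det_annihilator_mult: "p \<in> det_annihilator \<Longrightarrow> p * q \<in> det_annihilator"
  by (simp add: det_annihilator_def mult.assoc)

lemma det_annihilator_uminus: "p \<in> det_annihilator \<Longrightarrow> - p \<in> det_annihilator"
  using det_annihilator_mult[of p "- 1"] by simp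

lemma det_annihilator_minor_relation:
  "mvar (E i j) * mvar (E k l) + mvar (E i l) * mvar (E k j) \<in> det_annihilator"
  unfolding det_annihilator_def mem_Collect_eq
  by (intro allI, subst mult.commute) (simp only: diff_op_mult[of _ "_ + _"] diff_op_minor_relation diff_op_0)

lemma principal_minors_CARD: "(principal_minors CARD('n) :: 'n::finite gl_basis mpoly) = 1"
proof -
  have "(\<Sum>T\<in>UNIV. mconst (fixes_off \<pi> T * of_bool (card (UNIV - T) = CARD('n))) * row_monomial \<pi> T)
     = of_bool (\<pi> = id)" for \<pi> :: "'n \<Rightarrow> 'n"
  proof -
    have "card (UNIV - T) = CARD('n) \<longleftrightarrow> T = {}" for T :: "'n set"
      using card_subset_eq[of UNIV "UNIV - T"] by auto
    then have "(\<Sum>T\<in>UNIV. mconst (fixes_off \<pi> T * of_bool (card (UNIV - T) = CARD('n))) * row_monomial \<pi> T)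
     = (\<Sum>T\<in>{{}}. mconst (fixes_off \<pi> T) * row_monomial \<pi> T)"
      by (intro sum.mono_neutral_cong_right) auto
    also have "\<dots> = of_bool (\<pi> = id)"
    proof -
      have "fixes_off \<pi> {} = of_bool (\<pi> = id)"
        unfolding fixes_off_def by (cases "\<pi> = id") (auto simp: fun_eq_iff intro!: prod_zero)
      then show ?thesis by (simp add: row_monomial_def)
    qed
    finally show ?thesis .
  qed
  then have "principal_minors CARD('n) = (\<Sum>\<pi> | \<pi> permutes (UNIV :: 'n set). if \<pi> = id then of_int (sign \<pi>) else 0 :: 'n gl_basis mpoly)"
    unfolding principal_minors_def by (intro sum.cong) auto
  then show ?thesis by (simp add: sum.delta finite_permutations permutes_id)
qed

lemma one_notin_det_annihilator: "1 \<notin> (det_annihilator :: 'n::finite gl_basis mpoly set)"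
proof
  assume "1 \<in> (det_annihilator :: 'n gl_basis mpoly set)"
  then have "diff_op (1 * trace_var ^ CARD('n)) (det_poly :: 'n gl_basis mpoly) = 0"
    unfolding det_annihilator_def by blast
  then have "mconst (fact CARD('n)) = (0 :: 'n gl_basis mpoly)"
    by (simp only: mult_1_left diff_op_trace_var_power principal_minors_CARD mult_1_right)
  then have "Poly_Mapping.lookup (mconst (fact CARD('n)) :: 'n gl_basis mpoly) 0 = 0" by simp
  then show False by (simp add: mconst_def)
qed

definition apolar_cong :: "'n::finite gl_basis mpoly \<Rightarrow> 'n gl_basis mpoly \<Rightarrow> bool" where
  "apolar_cong p q \<longleftrightarrow> p - q \<in> det_annihilator"

lemma equivp_apolar_cong: "equivp apolar_cong"
proof (rule equivpI)
  show "reflp apolar_cong"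
    by (simp add: reflp_def apolar_cong_def det_annihilator_0)
  show "symp apolar_cong"
    unfolding symp_def apolar_cong_def using det_annihilator_uminus by fastforce
  show "transp apolar_cong"
    unfolding transp_def apolar_cong_def using det_annihilator_add by fastforce
qed

text \<open>
  The apolar algebra of the determinant: polynomials on \<open>gl\<^sub>n\<close> modulo the annihilator of the determinant.
\<close>

quotient_type 'n apolar = "'n::finite gl_basis mpoly" / apolar_cong
  by (rule equivp_apolar_cong)

instantiation apolar :: (finite) comm_ring_1
begin

lift_definition zero_apolar :: "'a apolar" is 0 .
lift_definition one_apolar :: "'a apolar" is 1 .

lift_definition plus_apolar :: "'a apolar \<Rightarrow> 'a apolar \<Rightarrow> 'a apolar" is plus
proof -
  fix p p' q q' :: "'a gl_basis mpoly"
  assume "apolar_cong p p'" and "apolar_cong q q'"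
  then have "(p - p') + (q - q') \<in> det_annihilator"
    unfolding apolar_cong_def by (rule det_annihilator_add)
  then show "apolar_cong (p + q) (p' + q')"
    unfolding apolar_cong_def by (simp add: algebra_simps)
qed

lift_definition uminus_apolar :: "'a apolar \<Rightarrow> 'a apolar" is uminus
  unfolding apolar_cong_def by (drule det_annihilator_uminus) simp

lift_definition minus_apolar :: "'a apolar \<Rightarrow> 'a apolar \<Rightarrow> 'a apolar" is minus
proof -
  fix p p' q q' :: "'a gl_basis mpoly"
  assume "apolar_cong p p'" and "apolar_cong q q'"
  then have "(p - p') + - (q - q') \<in> det_annihilator"
    unfolding apolar_cong_def by (intro det_annihilator_add det_annihilator_uminus)
  then show "apolar_cong (p - q) (p' - q')"
    unfolding apolar_cong_def by (simp add: algebra_simps)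
qed

lift_definition times_apolar :: "'a apolar \<Rightarrow> 'a apolar \<Rightarrow> 'a apolar" is times
proof -
  fix p p' q q' :: "'a gl_basis mpoly"
  assume "apolar_cong p p'" and "apolar_cong q q'"
  then have "(p - p') * q + (q - q') * p' \<in> det_annihilator"
    unfolding apolar_cong_def by (intro det_annihilator_add det_annihilator_mult)
  then show "apolar_cong (p * q) (p' * q')"
    unfolding apolar_cong_def by (simp add: algebra_simps)
qed

instance
proof
  have "- (0 - 1 :: 'a gl_basis mpoly) \<notin> det_annihilator"
    using one_notin_det_annihilator by simp
  then have "\<not> apolar_cong (0 :: 'a gl_basis mpoly) 1"
    unfolding apolar_cong_def using det_annihilator_uminus by blast
  then show "(0 :: 'a apolar) \<noteq> 1"
    by transfer
qed (transfer, simp add: algebra_simps equivp_reflp[OF equivp_apolar_cong])+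

end

lemma abs_apolar_hom:
  "abs_apolar 0 = 0" "abs_apolar 1 = 1"
  "abs_apolar (p + q) = abs_apolar p + abs_apolar q"
  "abs_apolar (p * q) = abs_apolar p * abs_apolar q"
  by (simp_all add: zero_apolar.abs_eq one_apolar.abs_eq plus_apolar.abs_eq times_apolar.abs_eq)

lemma abs_apolar_sum: "abs_apolar (sum f A) = (\<Sum>a\<in>A. abs_apolar (f a))"
  by (induction A rule: infinite_finite_induct) (simp_all add: abs_apolar_hom)

lemma abs_apolar_power: "abs_apolar (p ^ k) = abs_apolar p ^ k"
  by (induction k) (simp_all add: abs_apolar_hom)

lemma diff_op_apolar_eq:
  assumes "abs_apolar p = abs_apolar q"
  shows "diff_op p det_poly = diff_op q det_poly"
proof -
  have "p - q \<in> det_annihilator"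
    using assms by (simp add: apolar.abs_eq_iff apolar_cong_def)
  then have "diff_op ((p - q) * 1) det_poly = 0"
    unfolding det_annihilator_def by blast
  then have "diff_op (p - q) det_poly = 0"
    by (simp only: mult_1_right)
  then show ?thesis
    using diff_op_add_left[of "p - q" q det_poly] by (simp only: diff_add_cancel add_0_left)
qed

section \<open>Jacobi's formula\<close>

lemma fps_deriv_prod:
  fixes f :: "'i \<Rightarrow> 'a::comm_ring_1 fps"
  assumes "finite A"
  shows "fps_deriv (prod f A) = (\<Sum>i\<in>A. fps_deriv (f i) * prod f (A - {i}))"
  using assms
proof induction
  case (insert x A)
  have "insert x A - {i} = insert x (A - {i})" if "i \<in> A" for i using that insert by auto
  then have "(\<Sum>i\<in>A. fps_deriv (f i) * prod f (insert x A - {i})) = f x * (\<Sum>i\<in>A. fps_deriv (f i) * prod f (A - {i}))"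
    unfolding sum_distrib_left using insert by (intro sum.cong) (auto simp: mult_ac)
  then show ?case using insert by (simp add: add.commute mult.commute)
qed simp

text \<open>
  Jacobi's formula for \<open>M' = B M\<close>, with \<open>B\<close> given, so that no inverse of \<open>M\<close> is needed.
\<close>

theorem fps_deriv_det:
  fixes M B :: "'a::comm_ring_1 fps ^ 'm::finite ^ 'm"
  assumes "\<And>i j. fps_deriv (M $h i $h j) = (B ** M) $h i $h j"
  shows "fps_deriv (det M) = (\<Sum>i\<in>UNIV. B $h i $h i) * det M"
proof -
  have "fps_deriv (of_int z * f) = of_int z * fps_deriv f" for z and f :: "'a fps"
    by (simp flip: fps_of_int)
  then have "fps_deriv (det M) = (\<Sum>p | p permutes UNIV. of_int (sign p) *
      (\<Sum>i\<in>UNIV. fps_deriv (M $h i $h p i) * (\<Prod>j\<in>UNIV - {i}. M $h j $h p j)))"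
    by (simp add: det_def fps_deriv_sum fps_deriv_prod)
  also have "\<dots> = (\<Sum>i\<in>UNIV. \<Sum>p | p permutes UNIV. of_int (sign p) *
      (fps_deriv (M $h i $h p i) * (\<Prod>j\<in>UNIV - {i}. M $h j $h p j)))"
    unfolding sum_distrib_left by (rule sum.swap)
  also have "\<dots> = (\<Sum>i\<in>UNIV. det (\<chi> k. if k = i then (\<Sum>l\<in>UNIV. B $h i $h l *s M $h l) else M $h k))"
  proof (rule sum.cong[OF refl])
    fix i :: 'm
    have "fps_deriv (M $h i $h p i) * (\<Prod>j\<in>UNIV - {i}. M $h j $h p j)
       = (\<Prod>j\<in>UNIV. (\<chi> k. if k = i then (\<Sum>l\<in>UNIV. B $h i $h l *s M $h l) else M $h k) $h j $h p j)" for p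
      by (subst prod.remove[of UNIV i])
         (auto simp: assms matrix_matrix_mult_def sum_component intro!: arg_cong2[where f = "(*)"] prod.cong)
    then show "(\<Sum>p | p permutes UNIV. of_int (sign p) *
      (fps_deriv (M $h i $h p i) * (\<Prod>j\<in>UNIV - {i}. M $h j $h p j)))
      = det (\<chi> k. if k = i then (\<Sum>l\<in>UNIV. B $h i $h l *s M $h l) else M $h k)"
      unfolding det_def by simp
  qed
  also have "\<dots> = (\<Sum>i\<in>UNIV. B $h i $h i * det M)"
  proof (rule sum.cong[OF refl])
    fix i :: 'm
    have "det (\<chi> k. if k = i then (\<Sum>l\<in>UNIV. B $h i $h l *s M $h l) else M $h k)
      = (\<Sum>l\<in>UNIV. B $h i $h l * det (\<chi> k. if k = i then M $h l else M $h k))"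
      by (simp add: det_linear_row_sum det_row_mul)
    also have "\<dots> = (\<Sum>l\<in>UNIV. if l = i then B $h i $h i * det M else 0)"
    proof (rule sum.cong[OF refl])
      fix l
      have "det (\<chi> k. if k = i then M $h l else M $h k) = 0" if "l \<noteq> i"
        using that by (intro det_identical_rows[of i l]) (auto simp: row_def)
      moreover have "(\<chi> k. if k = i then M $h i else M $h k) = M"
        by (simp add: vec_eq_iff)
      ultimately show "B $h i $h l * det (\<chi> k. if k = i then M $h l else M $h k)
        = (if l = i then B $h i $h i * det M else 0)" by auto
    qed
    finally show "det (\<chi> k. if k = i then (\<Sum>l\<in>UNIV. B $h i $h l *s M $h l) else M $h k) = B $h i $h i * det M"
      by simp
  qed
  finally show ?thesis by (simp add: sum_distrib_right)
qed

section \<open>The adjoint representation over the apolar algebra\<close>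

text \<open>
  The classes in the apolar algebra of the coordinates, of the scalars and of the trace.
\<close>

definition ap_var :: "'n::finite \<Rightarrow> 'n \<Rightarrow> 'n apolar" where
  "ap_var i j = abs_apolar (mvar (E i j))"

definition ap_const :: "complex \<Rightarrow> 'n::finite apolar" where
  "ap_const c = abs_apolar (mconst c)"

definition ap_trace :: "'n::finite apolar" where
  "ap_trace = (\<Sum>i\<in>UNIV. ap_var i i)"

lemma ap_trace_eq: "ap_trace = abs_apolar trace_var"
  by (simp add: ap_trace_def ap_var_def trace_var_def abs_apolar_sum)

lemma ap_const_simps [simp]: "ap_const 0 = 0" "ap_const 1 = 1"
  and ap_const_add: "ap_const (c + d) = ap_const c + ap_const d"
  and ap_const_mult: "ap_const (c * d) = ap_const c * ap_const d"
  by (simp_all add: ap_const_def abs_apolar_hom mconst_add mconst_mult)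

lemma ap_const_diff: "ap_const (c - d) = ap_const c - ap_const d"
  by (simp only: eq_diff_eq flip: ap_const_add) simp

lemma ap_const_of_nat: "ap_const (of_nat k) = of_nat k"
  by (induction k) (simp_all add: ap_const_add)

lemma ap_const_sum: "ap_const (sum f A) = (\<Sum>a\<in>A. ap_const (f a))"
  by (induction A rule: infinite_finite_induct) (simp_all add: ap_const_add)

lemma ap_var_swap: "ap_var i j * ap_var k l = - (ap_var i l * ap_var k j)"
proof -
  have "apolar_cong (mvar (E i j) * mvar (E k l) + mvar (E i l) * mvar (E k j)) 0"
    using det_annihilator_minor_relation[of i j k l] by (simp add: apolar_cong_def)
  then have "ap_var i j * ap_var k l + ap_var i l * ap_var k j = 0"
    unfolding ap_var_def by (simp flip: abs_apolar_hom add: apolar.abs_eq_iff)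
  then show ?thesis by (simp add: eq_neg_iff_add_eq_0)
qed

lemma ap_var_contract:
  "(\<Sum>r\<in>UNIV. ap_var p r * ap_var r k) = - (ap_trace * ap_var p k)"
  "(\<Sum>r\<in>UNIV. ap_var r q * ap_var l r) = - (ap_trace * ap_var l q)"
proof -
  have "(\<Sum>r\<in>UNIV. ap_var p r * ap_var r k) = (\<Sum>r\<in>UNIV. - (ap_var r r * ap_var p k))" for p k
    by (rule sum.cong[OF refl], subst ap_var_swap) (simp add: mult.commute)
  then show *: "(\<Sum>r\<in>UNIV. ap_var p r * ap_var r k) = - (ap_trace * ap_var p k)" for p k
    by (simp add: sum_negf ap_trace_def sum_distrib_right)
  show "(\<Sum>r\<in>UNIV. ap_var r q * ap_var l r) = - (ap_trace * ap_var l q)"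
    using *[of l q] by (simp add: mult.commute)
qed

text \<open>
  The matrix of \<open>ad\<^sub>x\<close> over the apolar algebra.
\<close>

definition ap_ad :: "'n::finite apolar ^ 'n gl_basis ^ 'n gl_basis" where
  "ap_ad = (\<chi> c b. abs_apolar (ad_matrix $h c $h b))"

lemma sum_gl_basis: "(\<Sum>c\<in>UNIV. f c) = (\<Sum>r\<in>UNIV. \<Sum>s\<in>UNIV. f (E r s))"
proof -
  have "(\<Sum>c\<in>UNIV. f c) = (\<Sum>(r, s)\<in>UNIV. f (E r s))"
    unfolding UNIV_gl_basis by (subst sum.reindex) (auto simp: inj_def case_prod_unfold)
  then show ?thesis
    by (simp add: sum.cartesian_product)
qed

lemma if_sum_left: "(\<Sum>i\<in>A. if P then f i else 0) = (if P then sum f A else 0)"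
  by simp

lemma ap_ad_entry:
  "ap_ad $h (E p q) $h (E k l) = (if q = l then ap_var p k else 0) - (if p = k then ap_var l q else 0)"
proof -
  have "ap_ad $h (E p q) $h (E k l)
     = (\<Sum>i\<in>UNIV. \<Sum>j\<in>UNIV. ap_const (lie_sc (E i j) (E k l) (E p q)) * ap_var i j)"
    by (simp add: ap_ad_def ad_matrix_def abs_apolar_sum abs_apolar_hom ap_const_def ap_var_def sum_gl_basis)
  also have "\<dots> = (\<Sum>i\<in>UNIV. \<Sum>j\<in>UNIV. (if j = k then (if i = p then (if q = l then ap_var i j else 0) else 0) else 0))
      - (\<Sum>i\<in>UNIV. \<Sum>j\<in>UNIV. (if j = q then (if i = l then (if p = k then ap_var i j else 0) else 0) else 0))"
    unfolding sum_subtractf[symmetric]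
    by (intro sum.cong refl) (auto simp: ap_const_diff)
  also have "\<dots> = (if q = l then ap_var p k else 0) - (if p = k then ap_var l q else 0)"
    by (simp add: sum.delta)
  finally show ?thesis .
qed

lemma ap_ad_mult:
  "(ap_ad ** B) $h (E p q) $h b = (\<Sum>r\<in>UNIV. ap_var p r * B $h (E r q) $h b)
    - (\<Sum>s\<in>UNIV. ap_var s q * B $h (E p s) $h b)"
proof -
  have "(ap_ad ** B) $h (E p q) $h b
     = (\<Sum>r\<in>UNIV. \<Sum>s\<in>UNIV. ((if s = q then ap_var p r * B $h (E r s) $h b else 0)
       - (if r = p then ap_var s q * B $h (E r s) $h b else 0)))"
    unfolding matrix_matrix_mult_def sum_gl_basis
    by (auto simp: ap_ad_entry left_diff_distrib intro!: sum.cong)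
  also have "\<dots> = (\<Sum>r\<in>UNIV. \<Sum>s\<in>UNIV. (if s = q then ap_var p r * B $h (E r s) $h b else 0))
     - (\<Sum>s\<in>UNIV. \<Sum>r\<in>UNIV. (if r = p then ap_var s q * B $h (E r s) $h b else 0))"
    unfolding sum_subtractf by (subst (3) sum.swap) simp
  finally show ?thesis by (simp add: sum.delta)
qed

lemma ap_ad_square_entry:
  "(ap_ad ** ap_ad) $h (E p q) $h (E k l) =
     - (if q = l then ap_trace * ap_var p k else 0) - (if p = k then ap_trace * ap_var l q else 0)
     - 2 * (ap_var p k * ap_var l q)"
proof -
  have "(\<Sum>r\<in>UNIV. ap_var p r * ap_ad $h (E r q) $h (E k l))
      = (\<Sum>r\<in>UNIV. (if q = l then ap_var p r * ap_var r k else 0)) - (\<Sum>r\<in>UNIV. if r = k then ap_var p k * ap_var l q else 0)"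
    unfolding sum_subtractf[symmetric] by (rule sum.cong) (auto simp: ap_ad_entry algebra_simps)
  moreover have "(\<Sum>s\<in>UNIV. ap_var s q * ap_ad $h (E p s) $h (E k l))
      = (\<Sum>s\<in>UNIV. if s = l then ap_var l q * ap_var p k else 0) - (\<Sum>s\<in>UNIV. (if p = k then ap_var s q * ap_var l s else 0))"
    unfolding sum_subtractf[symmetric] by (rule sum.cong) (auto simp: ap_ad_entry algebra_simps)
  ultimately show ?thesis
    unfolding ap_ad_mult if_sum_left ap_var_contract by (simp add: sum.delta mult.commute)
qed

lemma ap_ad_trace_square:
  "(\<Sum>c\<in>UNIV. (ap_ad ** ap_ad) $h c $h c) = - (of_nat (2 * (CARD('n) + 1)) * (ap_trace :: 'n::finite apolar) ^ 2)"
proof -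
  have 1: "(\<Sum>p\<in>UNIV. \<Sum>q\<in>(UNIV :: 'n set). ap_trace * ap_var p p) = of_nat CARD('n) * (ap_trace :: 'n apolar) ^ 2"
    by (simp add: power2_eq_square ap_trace_def mult.left_commute flip: sum_distrib_left)
  have 2: "(\<Sum>p\<in>(UNIV :: 'n set). \<Sum>q\<in>UNIV. ap_trace * ap_var q q) = of_nat CARD('n) * (ap_trace :: 'n apolar) ^ 2"
    by (simp add: power2_eq_square ap_trace_def mult.left_commute flip: sum_distrib_left)
  have 3: "(\<Sum>p\<in>UNIV. \<Sum>q\<in>UNIV. 2 * (ap_var p p * ap_var q q)) = 2 * (ap_trace :: 'n apolar) ^ 2"
    by (simp add: power2_eq_square ap_trace_def sum_product flip: sum_distrib_left)
  show ?thesis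
    unfolding sum_gl_basis ap_ad_square_entry
    by (simp only: simp_thms if_True sum_subtractf sum_negf 1 2 3) (simp add: algebra_simps)
qed

text \<open>
  An ordinary matrix satisfies this when it is diagonalizable with two eigenvalues that differ by \<open>\<tau>\<close>. Here
  it follows from \<open>x\<^sup>2 = - \<tau> x\<close> (lemma \<open>ap_var_contract\<close>) for the generic matrix \<open>x\<close>.
\<close>

lemma ap_ad_cube: "(ap_ad ** (ap_ad ** ap_ad)) $h c $h b = ap_trace ^ 2 * ap_ad $h c $h b"
proof -
  obtain p q where c: "c = E p q" by (cases c)
  obtain k l where b: "b = E k l" by (cases b)
  let ?t = ap_trace
  have "(\<Sum>r\<in>UNIV. ap_var p r * (ap_ad ** ap_ad) $h (E r q) $h (E k l))
     = (\<Sum>r\<in>UNIV. if q = l then - (?t * (ap_var p r * ap_var r k)) else 0)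
       - (\<Sum>r\<in>UNIV. if r = k then ?t * ap_var p k * ap_var l q else 0)
       - (\<Sum>r\<in>UNIV. 2 * ap_var l q * (ap_var p r * ap_var r k))"
    unfolding sum_subtractf[symmetric]
    by (rule sum.cong) (auto simp: ap_ad_square_entry algebra_simps)
  also have "\<dots> = (if q = l then ?t ^ 2 * ap_var p k else 0) + ?t * (ap_var p k * ap_var l q)"
    unfolding if_sum_left
    by (simp add: sum_negf sum.delta ap_var_contract power2_eq_square flip: sum_distrib_left)
  finally have 1: "(\<Sum>r\<in>UNIV. ap_var p r * (ap_ad ** ap_ad) $h (E r q) $h (E k l))
      = (if q = l then ?t ^ 2 * ap_var p k else 0) + ?t * (ap_var p k * ap_var l q)" .
  have "(\<Sum>s\<in>UNIV. ap_var s q * (ap_ad ** ap_ad) $h (E p s) $h (E k l))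
     = (\<Sum>s\<in>UNIV. if p = k then - (?t * (ap_var s q * ap_var l s)) else 0)
       - (\<Sum>s\<in>UNIV. if s = l then ?t * ap_var p k * ap_var l q else 0)
       - (\<Sum>s\<in>UNIV. 2 * ap_var p k * (ap_var s q * ap_var l s))"
    unfolding sum_subtractf[symmetric]
    by (rule sum.cong) (auto simp: ap_ad_square_entry algebra_simps)
  also have "\<dots> = (if p = k then ?t ^ 2 * ap_var l q else 0) + ?t * (ap_var p k * ap_var l q)"
    unfolding if_sum_left
    by (simp add: sum_negf sum.delta ap_var_contract power2_eq_square flip: sum_distrib_left)
  finally have 2: "(\<Sum>s\<in>UNIV. ap_var s q * (ap_ad ** ap_ad) $h (E p s) $h (E k l))
      = (if p = k then ?t ^ 2 * ap_var l q else 0) + ?t * (ap_var p k * ap_var l q)" .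
  show ?thesis
    unfolding c b ap_ad_mult[of "ap_ad ** ap_ad"] 1 2 ap_ad_entry by (simp add: right_diff_distrib)
qed

lemma matrix_scale_mult_left:
  fixes A A' B :: "'a::comm_ring_1 ^ 'm::finite ^ 'm"
  assumes "\<And>c b. A' $h c $h b = t * A $h c $h b"
  shows "(A' ** B) $h c $h b = t * (A ** B) $h c $h b"
  by (simp add: matrix_matrix_mult_def assms sum_distrib_left mult.assoc)

lemma ap_ad_power: "(((**) ap_ad) ^^ (2 * j + 2)) (mat 1) $h c $h b
   = ap_trace ^ (2 * j) * (ap_ad ** ap_ad) $h c $h b"
proof (induction j arbitrary: c b)
  case 0
  show ?case by (simp add: numeral_2_eq_2)
next
  case (Suc j)
  let ?P = "(((**) ap_ad) ^^ (2 * j + 1)) (mat 1) :: 'a apolar ^ 'a gl_basis ^ 'a gl_basis"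
  have "(((**) ap_ad) ^^ (2 * Suc j + 2)) (mat 1) = (ap_ad ** (ap_ad ** ap_ad)) ** ?P"
    by (simp add: matrix_mul_assoc)
  then have "(((**) ap_ad) ^^ (2 * Suc j + 2)) (mat 1) $h c $h b = ap_trace ^ 2 * (ap_ad ** ?P) $h c $h b"
    using matrix_scale_mult_left[of "ap_ad ** (ap_ad ** ap_ad)" "ap_trace ^ 2" ap_ad, OF ap_ad_cube] by simp
  moreover have "ap_ad ** ?P = (((**) ap_ad) ^^ (2 * j + 2)) (mat 1)" by simp
  ultimately show ?case by (simp only: Suc.IH) (simp add: power2_eq_square mult.assoc)
qed

text \<open>
  Coefficientwise reduction of power series to the apolar algebra.
\<close>

definition ap_fps :: "'n::finite gl_basis mpoly fps \<Rightarrow> 'n apolar fps" where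
  "ap_fps F = Abs_fps (\<lambda>k. abs_apolar (F $ k))"

lemma ap_fps_hom:
  "ap_fps 1 = 1" "ap_fps 0 = 0"
  "ap_fps (F + G) = ap_fps F + ap_fps G"
  "ap_fps (F * G) = ap_fps F * ap_fps G"
  by (rule fps_ext; simp add: ap_fps_def abs_apolar_hom fps_mult_nth abs_apolar_sum)+

lemma ap_fps_sum: "ap_fps (sum f A) = (\<Sum>a\<in>A. ap_fps (f a))"
  by (induction A rule: infinite_finite_induct) (simp_all add: ap_fps_hom)

lemma ap_fps_prod: "ap_fps (prod f A) = (\<Prod>a\<in>A. ap_fps (f a))"
  by (induction A rule: infinite_finite_induct) (simp_all add: ap_fps_hom)

lemma ap_fps_of_int: "ap_fps (of_int z) = (of_int z :: 'n::finite apolar fps)"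
proof -
  have "ap_fps (- F) = - ap_fps F" for F :: "'n gl_basis mpoly fps"
    using ap_fps_hom(3)[of F "- F"] by (simp add: ap_fps_hom eq_neg_iff_add_eq_0 add.commute)
  then have "ap_fps (F - G) = ap_fps F - ap_fps G" for F G :: "'n gl_basis mpoly fps"
    using ap_fps_hom(3)[of F "- G"] by simp
  then show ?thesis
    by (induction z rule: int_induct[where k = 0]) (simp_all add: ap_fps_hom)
qed

lemma ap_fps_det: "ap_fps (det M) = det (\<chi> i j. ap_fps (M $h i $h j))"
  by (simp add: det_def ap_fps_sum ap_fps_hom ap_fps_prod ap_fps_of_int)

text \<open>
  The substitution of \<open>s \<tau>\<close> for the variable of a complex power series, where \<open>s\<close> is the new variable.
\<close>

definition ap_scaled :: "complex fps \<Rightarrow> 'n::finite apolar fps" where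
  "ap_scaled f = Abs_fps (\<lambda>k. ap_const (f $ k) * ap_trace ^ k)"

lemma ap_scaled_1: "ap_scaled 1 = 1"
  by (rule fps_ext) (simp add: ap_scaled_def)

lemma ap_scaled_mult: "ap_scaled (f * g) = (ap_scaled f * ap_scaled g :: 'n::finite apolar fps)"
proof (rule fps_ext)
  fix k
  have "ap_const (f $ i * g $ (k - i)) * ap_trace ^ k
      = (ap_const (f $ i) * ap_trace ^ i) * (ap_const (g $ (k - i)) * (ap_trace ^ (k - i) :: 'n apolar))"
    if "i \<le> k" for i
  proof -
    have "ap_trace ^ k = ap_trace ^ i * (ap_trace ^ (k - i) :: 'n apolar)"
      using that by (simp flip: power_add)
    then show ?thesis by (simp add: ap_const_mult mult_ac)
  qed
  then show "ap_scaled (f * g) $ k = (ap_scaled f * ap_scaled g :: 'n apolar fps) $ k"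
    unfolding ap_scaled_def fps_mult_nth fps_nth_Abs_fps ap_const_sum sum_distrib_right
    by (intro sum.cong) auto
qed

lemma ap_scaled_power: "ap_scaled (f ^ k) = ap_scaled f ^ k"
  by (induction k) (simp_all add: ap_scaled_1 ap_scaled_mult)

lemma fps_const_of_sum: "fps_const (sum f A) = (\<Sum>a\<in>A. fps_const (f a :: 'a::comm_ring_1))"
  by (induction A rule: infinite_finite_induct) (simp_all flip: fps_const_add)

text \<open>
  The apolar algebra has zero divisors, but positive integers are invertible in it because it is an
  algebra over \<open>\<complex>\<close>.
\<close>

lemma fps_deriv_0_imp_const:
  fixes F :: "'n::finite apolar fps"
  assumes "fps_deriv F = 0"
  shows "F = fps_const (F $ 0)"
proof (rule fps_ext)
  fix k
  show "F $ k = fps_const (F $ 0) $ k"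
  proof (cases k)
    case (Suc m)
    have "of_nat (Suc m) * F $ Suc m = 0"
      using assms by (metis fps_deriv_nth fps_zero_nth Suc_eq_plus1)
    then have "ap_const (1 / of_nat (Suc m)) * (ap_const (of_nat (Suc m)) * F $ Suc m) = 0"
      by (simp only: ap_const_of_nat mult_zero_right)
    then show ?thesis
      by (simp add: Suc flip: mult.assoc ap_const_mult del: of_nat_Suc)
  qed simp
qed

section \<open>The Duflo operator on the determinant\<close>

text \<open>
  By \<open>ad\<^sup>3 = \<tau>\<^sup>2 ad\<close>, the matrix is \<open>M = 1 + C ad\<^sup>2\<close> for a scalar series \<open>C\<close> with \<open>G = g(s \<tau>) = 1 + C \<tau>\<^sup>2\<close>, and
  \<open>M' = (C' / G) ad\<^sup>2 M\<close>. Hence \<open>J = det M\<close> satisfies \<open>G J' = - m G' J\<close> with \<open>m = 2 (n + 1)\<close>,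
  because \<open>tr (ad\<^sup>2) = - m \<tau>\<^sup>2\<close>; so \<open>J * G\<close>\<open>\<^sup>m\<close> is constant.
\<close>

lemma ap_fps_duflo_J:
  "ap_fps (duflo_J TYPE('n::finite gl_basis)) * ap_scaled sinhc_half ^ (2 * (CARD('n) + 1)) = 1"
proof -
  define S where "S = (ap_ad ** ap_ad :: 'n apolar ^ 'n gl_basis ^ 'n gl_basis)"
  define G where "G = (ap_scaled sinhc_half :: 'n apolar fps)"
  define Ginv where "Ginv = (ap_scaled (inverse sinhc_half) :: 'n apolar fps)"
  define C where "C = (Abs_fps (\<lambda>k. if k \<ge> 2 then ap_const (sinhc_half $ k) * ap_trace ^ (k - 2) else 0) :: 'n apolar fps)"
  define M where "M = (\<chi> c b. ap_fps (Abs_fps (\<lambda>k.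
     mconst (sinhc_half $ k) * ((((**) ad_matrix) ^^ k) (mat 1)) $h c $h b)) :: 'n apolar fps ^ 'n gl_basis ^ 'n gl_basis)"
  define K where "K = fps_deriv C * Ginv"
  define B where "B = (\<chi> c b. K * fps_const (S $h c $h b))"
  define m where "m = 2 * (CARD('n) + 1)"
  have GG: "G * Ginv = 1"
    unfolding G_def Ginv_def ap_scaled_mult[symmetric]
    by (simp add: ap_scaled_1 inverse_mult_eq_1' sinhc_half_nth)
  have GC: "G = 1 + C * fps_const (ap_trace ^ 2)"
  proof (rule fps_ext)
    fix k
    have "ap_trace ^ k = ap_trace ^ (k - 2) * (ap_trace ^ 2 :: 'n apolar)" if "k \<ge> 2"
      using that power_add[of ap_trace "k - 2" 2] by (simp only: le_add_diff_inverse2)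
    moreover have "k < 2 \<Longrightarrow> k = 0 \<or> k = 1" by auto
    ultimately show "G $ k = (1 + C * fps_const (ap_trace ^ 2)) $ k"
      by (auto simp: G_def C_def ap_scaled_def sinhc_half_nth mult.assoc not_le)
  qed
  have M: "M $h c $h b = fps_const (mat 1 $h c $h b) + C * fps_const (S $h c $h b)" for c b
  proof (rule fps_ext)
    fix k
    have P: "abs_apolar ((((**) ad_matrix) ^^ k) (mat 1) $h c $h b) = (((**) ap_ad) ^^ k) (mat 1) $h c $h b" for k and c b :: "'n gl_basis"
      by (induction k arbitrary: c b)
         (simp_all add: mat_def matrix_matrix_mult_def abs_apolar_hom abs_apolar_sum ap_ad_def)
    have Mk: "M $h c $h b $ k = ap_const (sinhc_half $ k) * (((**) ap_ad) ^^ k) (mat 1) $h c $h b"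
      by (simp add: M_def ap_fps_def abs_apolar_hom ap_const_def P)
    show "M $h c $h b $ k = (fps_const (mat 1 $h c $h b) + C * fps_const (S $h c $h b)) $ k"
    proof (cases "k = 0 \<or> odd k")
      case True
      then show ?thesis unfolding Mk by (auto simp: sinhc_half_nth C_def)
    next
      case False
      then obtain i where "k = 2 * i" "i > 0" by auto
      then obtain j where k: "k = 2 * j + 2" by (cases i) auto
      show ?thesis unfolding Mk unfolding k ap_ad_power by (simp add: C_def S_def mult.assoc)
    qed
  qed
  have SS: "(\<Sum>d\<in>UNIV. S $h c $h d * S $h d $h b) = ap_trace ^ 2 * S $h c $h b" for c b
  proof -
    have "S ** S = (ap_ad ** (ap_ad ** ap_ad)) ** ap_ad"
      by (simp add: S_def matrix_mul_assoc)
    then have "(S ** S) $h c $h b = ap_trace ^ 2 * S $h c $h b"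
      using matrix_scale_mult_left[of "ap_ad ** (ap_ad ** ap_ad)" "ap_trace ^ 2" ap_ad, OF ap_ad_cube]
      by (simp add: S_def)
    then show ?thesis by (simp add: matrix_matrix_mult_def)
  qed
  have "fps_deriv (M $h c $h b) = (B ** M) $h c $h b" for c b
  proof -
    have "(B ** M) $h c $h b = (\<Sum>d\<in>UNIV. K * fps_const (S $h c $h d) * fps_const (mat 1 $h d $h b))
      + (\<Sum>d\<in>UNIV. K * C * fps_const (S $h c $h d * S $h d $h b))"
      unfolding matrix_matrix_mult_def sum.distrib[symmetric]
      by (simp add: B_def M distrib_left mult_ac flip: fps_const_mult)
    also have "(\<Sum>d\<in>UNIV. K * fps_const (S $h c $h d) * fps_const (mat 1 $h d $h b))
      = (\<Sum>d\<in>UNIV. if d = b then K * fps_const (S $h c $h b) else 0)"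
      by (rule sum.cong) (auto simp: mat_def)
    also have "\<dots> = K * fps_const (S $h c $h b)" by simp
    also have "(\<Sum>d\<in>UNIV. K * C * fps_const (S $h c $h d * S $h d $h b))
      = K * C * fps_const (ap_trace ^ 2 * S $h c $h b)"
      unfolding SS[symmetric] sum_distrib_left[symmetric] by (simp add: fps_const_of_sum)
    also have "K * fps_const (S $h c $h b) + \<dots> = K * G * fps_const (S $h c $h b)"
      unfolding GC by (simp add: algebra_simps flip: fps_const_mult)
    also have "K * G = fps_deriv C"
      unfolding K_def using GG by (simp add: mult.assoc mult.commute[of Ginv])
    finally show ?thesis by (simp add: M)
  qed
  from fps_deriv_det[OF this]
  have "fps_deriv (det M) = (\<Sum>c\<in>UNIV. B $h c $h c) * det M" .
  also have "(\<Sum>c\<in>UNIV. B $h c $h c) = - (of_nat m * (fps_deriv C * fps_const (ap_trace ^ 2) * Ginv))"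
  proof -
    have "(\<Sum>c\<in>UNIV. B $h c $h c) = K * fps_const (\<Sum>c\<in>UNIV. S $h c $h c)"
      by (simp add: B_def fps_const_of_sum flip: sum_distrib_left)
    also have "\<dots> = - (of_nat m * (K * fps_const (ap_trace ^ 2)))"
      unfolding S_def ap_ad_trace_square m_def[symmetric]
      by (simp add: mult_ac flip: fps_const_neg fps_const_mult fps_of_nat)
    finally show ?thesis by (simp add: K_def mult_ac)
  qed
  also have "fps_deriv C * fps_const (ap_trace ^ 2) = fps_deriv G"
    by (simp add: GC)
  finally have "fps_deriv (det M) = - (of_nat m * (fps_deriv G * Ginv)) * det M" .
  then have "G * fps_deriv (det M) = - ((G * Ginv) * (of_nat m * fps_deriv G * det M))"
    by (simp add: mult_ac)
  then have J': "G * fps_deriv (det M) = - (of_nat m * fps_deriv G * det M)"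
    unfolding GG by simp
  have Gm: "G ^ m = G * G ^ (m - 1)"
    by (simp add: m_def flip: power_Suc)
  have "fps_deriv (det M * G ^ m) = (G * fps_deriv (det M) + of_nat m * fps_deriv G * det M) * G ^ (m - 1)"
    unfolding fps_deriv_mult fps_deriv_power'[of G m] by (simp add: Gm algebra_simps)
  then have "fps_deriv (det M * G ^ m) = 0" unfolding J' by simp
  from fps_deriv_0_imp_const[OF this]
  have c: "det M * G ^ m = fps_const ((det M * G ^ m) $ 0)" .
  have J: "ap_fps (duflo_J TYPE('n gl_basis)) = det M"
    unfolding duflo_J_def ap_fps_det M_def by (simp only: vec_lambda_beta)
  have "det M $ 0 = 1"
    unfolding J[symmetric] by (simp add: ap_fps_def duflo_J_nth_0 abs_apolar_hom)
  moreover have "G $ 0 = 1" by (simp add: G_def ap_scaled_def sinhc_half_nth)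
  then have "(G ^ m) $ 0 = 1" by (simp add: fps_power_zeroth)
  ultimately have z: "(det M * G ^ m) $ 0 = 1" by simp
  have "det M * G ^ m = fps_const 1" using c unfolding z .
  then show ?thesis by (simp only: J G_def m_def fps_const_1_eq_1)
qed

lemma ap_fps_duflo_J_sqrt:
  "ap_fps (duflo_J_sqrt TYPE('n::finite gl_basis)) = ap_scaled (inverse sinhc_half ^ Suc CARD('n))"
proof -
  define G where "G = (ap_scaled sinhc_half :: 'n apolar fps)"
  define F where "F = ap_fps (duflo_J_sqrt TYPE('n gl_basis))"
  define n where "n = Suc CARD('n)"
  have "ap_const 2 = (2 :: 'n apolar)"
    using ap_const_of_nat[of 2] by simp
  then have "2 * ap_const (1/2) = (ap_const (2 * (1/2)) :: 'n apolar)"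
    by (simp only: ap_const_mult)
  then have h: "2 * ap_const (1/2) = (1 :: 'n apolar)" by simp
  have "F ^ 2 = ap_fps (duflo_J TYPE('n gl_basis))"
    unfolding F_def duflo_J_sqrt(2)[symmetric] by (simp add: power2_eq_square ap_fps_hom)
  moreover have "(G ^ n) ^ 2 = G ^ (2 * (CARD('n) + 1))"
    unfolding power_mult[symmetric] n_def by (simp only: Suc_eq_plus1 mult.commute)
  ultimately have sq: "(F * G ^ n) ^ 2 = 1"
    using ap_fps_duflo_J[where 'n='n] by (simp only: power_mult_distrib G_def)
  have "F $ 0 = 1" by (simp add: F_def ap_fps_def duflo_J_sqrt abs_apolar_hom)
  moreover have "G $ 0 = 1" by (simp add: G_def ap_scaled_def sinhc_half_nth)
  ultimately have "(F * G ^ n) $ 0 = 1" by (simp add: fps_power_zeroth)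
  \<comment> \<open>A power series with constant coefficient 1 and square 1 is 1.\<close>
  have *: "F * G ^ n = 1"
  proof -
    have "\<exists>!A. A $ 0 = 1 \<and> A ^ 2 = (1 :: 'n apolar fps)"
      by (rule fps_sqrt_ex1[OF h]) simp
    moreover have "(1 :: 'n apolar fps) $ 0 = 1 \<and> (1 :: 'n apolar fps) ^ 2 = 1" by simp
    ultimately show ?thesis
      using sq \<open>(F * G ^ n) $ 0 = 1\<close> by blast
  qed
  have "G ^ n * ap_scaled (inverse sinhc_half ^ n) = 1"
    unfolding G_def ap_scaled_power[symmetric] ap_scaled_mult[symmetric] power_mult_distrib[symmetric]
    by (simp add: inverse_mult_eq_1' sinhc_half_nth ap_scaled_1)
  moreover have "F * (G ^ n * ap_scaled (inverse sinhc_half ^ n)) = (F * G ^ n) * ap_scaled (inverse sinhc_half ^ n)"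
    by (simp only: mult.assoc)
  ultimately have "F = ap_scaled (inverse sinhc_half ^ n)"
    unfolding * by simp
  then show ?thesis by (simp only: F_def n_def)
qed

lemma diff_op_duflo_J_sqrt_det:
  "diff_op (duflo_J_sqrt TYPE('n::finite gl_basis) $ k) det_poly
    = mconst ((inverse sinhc_half ^ Suc CARD('n)) $ k * fact k) * principal_minors k"
proof -
  let ?b = "(inverse sinhc_half ^ Suc CARD('n)) $ k"
  have "abs_apolar (duflo_J_sqrt TYPE('n gl_basis) $ k) = abs_apolar (mconst ?b * trace_var ^ k)"
    using arg_cong[OF ap_fps_duflo_J_sqrt[where 'n='n], of "\<lambda>F. F $ k"]
    by (simp add: ap_fps_def ap_scaled_def abs_apolar_hom abs_apolar_power ap_const_def ap_trace_eq)
  then have "diff_op (duflo_J_sqrt TYPE('n gl_basis) $ k) det_poly = diff_op (mconst ?b * trace_var ^ k) det_poly"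
    by (rule diff_op_apolar_eq)
  also have "\<dots> = mconst ?b * (mconst (fact k) * principal_minors k)"
    by (simp only: diff_op_mult diff_op_mconst diff_op_trace_var_power)
  finally show ?thesis by (simp only: mconst_mult mult.assoc)
qed

lemma diff_op_series_det:
  "diff_op_series (duflo_J_sqrt TYPE('n::finite gl_basis)) det_poly
    = (\<Sum>\<pi> | \<pi> permutes UNIV. of_int (sign \<pi>) * (\<Sum>T\<in>UNIV.
        mconst (fixes_off \<pi> T * fact (CARD('n) - card T) *
          (inverse sinhc_half ^ Suc CARD('n)) $ (CARD('n) - card T)) * row_monomial \<pi> T))"
proof -
  define b where "b k = (inverse sinhc_half ^ Suc CARD('n)) $ k * fact k" for k
  define c where "c \<pi> k T = fixes_off \<pi> T * of_bool (card (UNIV - T) = k)" for \<pi> :: "'n \<Rightarrow> 'n" and k T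
  have "diff_op_series (duflo_J_sqrt TYPE('n::finite gl_basis)) det_poly
     = Sum_any (\<lambda>k. mconst (b k) * (principal_minors k :: 'n gl_basis mpoly))"
    unfolding diff_op_series_def diff_op_duflo_J_sqrt_det b_def ..
  also have "\<dots> = (\<Sum>k\<le>CARD('n). mconst (b k) * principal_minors k)"
  proof (rule Sum_any.expand_superset)
    show "{k. mconst (b k) * (principal_minors k :: 'n gl_basis mpoly) \<noteq> 0} \<subseteq> {..CARD('n)}"
    proof (rule subsetI, rule ccontr)
      fix k assume "k \<in> {k. mconst (b k) * (principal_minors k :: 'n gl_basis mpoly) \<noteq> 0}" "k \<notin> {..CARD('n)}"
      then show False by (simp add: not_le principal_minors_eq_0)
    qed
  qed simp
  also have "\<dots> = (\<Sum>k\<le>CARD('n). \<Sum>\<pi> | \<pi> permutes UNIV. of_int (sign \<pi>) *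
      (\<Sum>T\<in>UNIV. mconst (b k * c \<pi> k T) * row_monomial \<pi> T))"
    unfolding principal_minors_def c_def[symmetric]
    by (simp only: sum_distrib_left mconst_mult mult_ac)
  also have "\<dots> = (\<Sum>\<pi> | \<pi> permutes UNIV. of_int (sign \<pi>) *
      (\<Sum>k\<le>CARD('n). \<Sum>T\<in>UNIV. mconst (b k * c \<pi> k T) * row_monomial \<pi> T))"
    by (subst sum.swap) (simp only: sum_distrib_left)
  also have "\<dots> = (\<Sum>\<pi> | \<pi> permutes UNIV. of_int (sign \<pi>) *
      (\<Sum>T\<in>UNIV. mconst (fixes_off \<pi> T * b (CARD('n) - card T)) * row_monomial \<pi> T))"
  proof (intro sum.cong refl arg_cong2[where f = "(*)"])
    fix \<pi> :: "'n \<Rightarrow> 'n"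
    have "(\<Sum>k\<le>CARD('n). mconst (b k * c \<pi> k T) * row_monomial \<pi> T)
        = mconst (fixes_off \<pi> T * b (CARD('n) - card T)) * row_monomial \<pi> T" for T
    proof -
      have "(\<Sum>k\<le>CARD('n). mconst (b k * c \<pi> k T) * row_monomial \<pi> T)
        = (\<Sum>k\<le>CARD('n). if k = CARD('n) - card T then mconst (fixes_off \<pi> T * b (CARD('n) - card T)) * row_monomial \<pi> T else 0)"
        by (rule sum.cong) (auto simp: c_def card_Diff_subset mult.commute)
      then show ?thesis by simp
    qed
    then show "(\<Sum>k\<le>CARD('n). \<Sum>T\<in>UNIV. mconst (b k * c \<pi> k T) * row_monomial \<pi> T)
       = (\<Sum>T\<in>UNIV. mconst (fixes_off \<pi> T * b (CARD('n) - card T)) * row_monomial \<pi> T)"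
      by (subst sum.swap) simp
  qed
  finally show ?thesis by (simp only: b_def mult_ac)
qed

theorem proposition1:
  shows "Duflo (det (\<chi> i j. mvar (E i j))) =
    col_det ((\<chi> i j. uvar (E i j)) + diag_matrix (\<lambda>i. uconst (of_nat (card {i<..})))
      - mat (uconst ((of_nat CARD('n) - 1) / 2))
      :: 'n::{finite,linorder} gl_basis uea ^ 'n::{finite,linorder} ^ 'n::{finite,linorder})"
proof -
  have "Sym (of_int z * p) = of_int z * Sym p" for z and p :: "'n gl_basis mpoly"
    using Sym_mconst_mult[of "of_int z" p] by (simp add: mconst_of_int uconst_of_int)
  then show ?thesis
    unfolding det_poly_def[symmetric] Duflo_def diff_op_series_det col_det_capelli
    by (simp only: Sym_sum Sym_mconst_mult row_monomial_def)
qed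

end
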